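(* Let $T=(V,E)$ be a finite tree with $n$ nodes and $\mathcal{M}\in\{\mathcal{MIN},\mathcal{MAJ}\}$. The algorithm described below computes all fixed points of $T$ — its output list consists of exactly the sets in $E_{fix}(T)$, each appearing once, which correspond one-to-one to the fixed points of $\mathcal{M}$ assigning color $0$ to a distinguished node $v^\ast$ — in time $O(n+|\mathcal{F}_{\mathcal{M}}(T)|\cdot|E^2(T)|)$ using $O(|E^2(T)|\cdot|\mathcal{F}_{\mathcal{M}}(T)|)$ memory.
   Context: Colorings are maps $c:V\to\{0,1\}$; $N^i(v)$ is the set of neighbors of $v$ with color $i$. $\mathcal{MIN}(c)(v)=c(v)$ if $|N^{c(v)}(v)|\le|N^{1-c(v)}(v)|$, else $1-c(v)$; $\mathcal{MAJ}(c)(v)=c(v)$ if $|N^{c(v)}(v)|\ge|N^{1-c(v)}(v)|$, else $1-c(v)$. $\mathcal{F}_{\mathcal{M}}(T)$ is the set of $c$ with $\mathcal{M}(c)=c$. $E^2(T)$ is the set of edges whose both end nodes have degree $\ge 2$. For $X\subseteq E$, $X_v$ is the number of edges of $X$ incident to $v$; $X\subseteq E^2(T)$ is legal if $X_v\le\deg(v)/2$ for all $v$; $E_{fix}(T)$ is the set of legal subsets of $E^2(T)$. The algorithm: compute $E^2(T)$ and a list $L$ initialized to contain only $\emptyset$. For each edge $e\in E^2(T)$ (in some order): let $count$ be the current length of $L$; for each of the first $count$ entries $X$ of $L$ (in order), if $\{e\}\cup X$ is legal, append $\{e\}\cup X$ to $L$. Finally return $L$. *)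

theory Defs
  imports Complex_Main "HOL-Library.FuncSet"
begin

section \<open>Trees\<close>

definition simple_graph :: "'a set \<Rightarrow> 'a set set \<Rightarrow> bool" where
  "simple_graph V E \<longleftrightarrow> finite V \<and> E \<subseteq> {{u, v} | u v. u \<in> V \<and> v \<in> V \<and> u \<noteq> v}"

definition connected_graph :: "'a set \<Rightarrow> 'a set set \<Rightarrow> bool" where
  "connected_graph V E \<longleftrightarrow> (\<forall>u\<in>V. \<forall>v\<in>V. (u, v) \<in> {(x, y). {x, y} \<in> E}\<^sup>*)"

definition cycle :: "'a set set \<Rightarrow> 'a list \<Rightarrow> bool" where
  "cycle E p \<longleftrightarrow> length p \<ge> 3 \<and> distinct p \<and>
     (\<forall>i<length p. {p ! i, p ! (Suc i mod length p)} \<in> E)"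

definition tree :: "'a set \<Rightarrow> 'a set set \<Rightarrow> bool" where
  "tree V E \<longleftrightarrow> simple_graph V E \<and> V \<noteq> {} \<and> connected_graph V E \<and> (\<nexists>p. cycle E p)"

definition nbrs :: "'a set set \<Rightarrow> 'a \<Rightarrow> 'a set" where
  "nbrs E v = {w. {v, w} \<in> E}"

text \<open>\<open>incidence X v\<close> is the number $X_v$ of edges of \<open>X\<close> at \<open>v\<close>; the degree of \<open>v\<close> is $E_v$.\<close>

definition incidence :: "'a set set \<Rightarrow> 'a \<Rightarrow> nat" where
  "incidence X v = card {e \<in> X. v \<in> e}"

abbreviation degree :: "'a set set \<Rightarrow> 'a \<Rightarrow> nat" where
  "degree E v \<equiv> incidence E v"

definition E2 :: "'a set set \<Rightarrow> 'a set set" where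
  "E2 E = {e \<in> E. \<forall>v\<in>e. degree E v \<ge> 2}"

definition legal :: "'a set \<Rightarrow> 'a set set \<Rightarrow> 'a set set \<Rightarrow> bool" where
  "legal V E X \<longleftrightarrow> X \<subseteq> E2 E \<and> (\<forall>v\<in>V. real (incidence X v) \<le> real (degree E v) / 2)"

definition E_fix :: "'a set \<Rightarrow> 'a set set \<Rightarrow> 'a set set set" where
  "E_fix V E = {X. legal V E X}"


section \<open>Minority and majority process\<close>

datatype process = Minority | Majority

definition color_nbrs :: "'a set set \<Rightarrow> ('a \<Rightarrow> nat) \<Rightarrow> nat \<Rightarrow> 'a \<Rightarrow> 'a set" where
  "color_nbrs E c i v = {w \<in> nbrs E v. c w = i}"

fun apply_process :: "process \<Rightarrow> 'a set \<Rightarrow> 'a set set \<Rightarrow> ('a \<Rightarrow> nat) \<Rightarrow> ('a \<Rightarrow> nat)" where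
  "apply_process Minority V E c =
     (\<lambda>v\<in>V. if card (color_nbrs E c (c v) v) \<le> card (color_nbrs E c (1 - c v) v)
            then c v else 1 - c v)"
| "apply_process Majority V E c =
     (\<lambda>v\<in>V. if card (color_nbrs E c (c v) v) \<ge> card (color_nbrs E c (1 - c v) v)
            then c v else 1 - c v)"

definition fixed_points :: "process \<Rightarrow> 'a set \<Rightarrow> 'a set set \<Rightarrow> ('a \<Rightarrow> nat) set" where
  "fixed_points M V E = {c \<in> V \<rightarrow>\<^sub>E {0, 1}. apply_process M V E c = c}"

text \<open>The edge set that encodes a fixed point: its monochromatic edges for \<open>Minority\<close>, its
  bichromatic edges for \<open>Majority\<close>.\<close>

fun conflict_edges :: "process \<Rightarrow> 'a set set \<Rightarrow> ('a \<Rightarrow> nat) \<Rightarrow> 'a set set" where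
  "conflict_edges Minority E c = {e \<in> E. \<forall>u\<in>e. \<forall>v\<in>e. c u = c v}"
| "conflict_edges Majority E c = {e \<in> E. \<exists>u\<in>e. \<exists>v\<in>e. c u \<noteq> c v}"


section \<open>The algorithm\<close>

definition is_order :: "'b list \<Rightarrow> 'b set \<Rightarrow> bool" where
  "is_order xs A \<longleftrightarrow> distinct xs \<and> set xs = A"

text \<open>One round of the outer loop. The inner loop only visits the entries present at its start
  and appends in the order of the visit.\<close>

definition extend :: "'a set \<Rightarrow> 'a set set \<Rightarrow> 'a set \<Rightarrow> 'a set set list \<Rightarrow> 'a set set list" where
  "extend V E e L = L @ filter (legal V E) (map (\<lambda>X. {e} \<union> X) L)"

definition legal_list :: "'a set \<Rightarrow> 'a set set \<Rightarrow> 'a set list \<Rightarrow> 'a set set list" where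
  "legal_list V E es = fold (extend V E) es [{}]"


section \<open>A random access machine\<close>

text \<open>Unit-cost RAM with a fixed finite set of registers, a read-only input and a working memory,
  all holding natural numbers. The only arithmetic is addition and truncated subtraction.\<close>

datatype reg = rN | rK | rRoot | rV | rU | rW | rA | rB | rC | rD | rI | rJ
  | rP | rQ | rX | rY | rZ | rDA | rDJ | rBase | rWidth | rFree | rLen | rCount

datatype aexp = Cn nat | Rg reg
  | Plus aexp aexp (infixl \<open>\<oplus>\<close> 65) | Minus aexp aexp (infixl \<open>\<ominus>\<close> 65)

datatype bexp = Less aexp aexp (infix \<open>\<lless>\<close> 50) | Neq aexp aexp (infix \<open>\<noteq>\<^sub>b\<close> 50)
  | And bexp bexp (infixr \<open>\<and>\<^sub>b\<close> 35)

datatype com =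
    Skip
  | Assign reg aexp           (\<open>_ ::= _\<close> [61, 61] 61)
  | Input reg aexp            (\<open>_ ::= INP[_]\<close> [61, 0] 61)
  | Load reg aexp             (\<open>_ ::= MEM[_]\<close> [61, 0] 61)
  | Store aexp aexp           (\<open>MEM[_] ::= _\<close> [0, 61] 61)
  | Seq com com               (infixr \<open>;;\<close> 60)
  | Cond bexp com com         (\<open>(IF _/ THEN _/ ELSE _)\<close> [0, 0, 61] 61)
  | While bexp com            (\<open>(WHILE _/ DO _)\<close> [0, 61] 61)

record state =
  regs :: "reg \<Rightarrow> nat"
  mem :: "nat \<Rightarrow> nat"

fun aval :: "aexp \<Rightarrow> (reg \<Rightarrow> nat) \<Rightarrow> nat" where
  "aval (Cn n) r = n"
| "aval (Rg x) r = r x"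
| "aval (a \<oplus> b) r = aval a r + aval b r"
| "aval (a \<ominus> b) r = aval a r - aval b r"

fun bval :: "bexp \<Rightarrow> (reg \<Rightarrow> nat) \<Rightarrow> bool" where
  "bval (a \<lless> b) r \<longleftrightarrow> aval a r < aval b r"
| "bval (a \<noteq>\<^sub>b b) r \<longleftrightarrow> aval a r \<noteq> aval b r"
| "bval (a \<and>\<^sub>b b) r \<longleftrightarrow> bval a r \<and> bval b r"

text \<open>\<open>run inp c s t m s'\<close>: on input \<open>inp\<close>, started in \<open>s\<close>, the command \<open>c\<close> halts in \<open>s'\<close> after \<open>t\<close>
  steps and accesses only memory cells with addresses below \<open>m\<close>, where \<open>m\<close> is least possible.
  Expressions occurring in a fixed program have constant size, so each of their evaluations is
  charged as part of the single step of the command they belong to. The length of the numbers is not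
  bounded: the list may be exponentially long, and addresses have to reach all of it.\<close>

inductive run :: "(nat \<Rightarrow> nat) \<Rightarrow> com \<Rightarrow> state \<Rightarrow> nat \<Rightarrow> nat \<Rightarrow> state \<Rightarrow> bool"
  for inp :: "nat \<Rightarrow> nat" where
  Skip: "run inp Skip s 1 0 s"
| Assign: "run inp (x ::= a) s 1 0 (s\<lparr>regs := (regs s)(x := aval a (regs s))\<rparr>)"
| Input: "run inp (x ::= INP[a]) s 1 0 (s\<lparr>regs := (regs s)(x := inp (aval a (regs s)))\<rparr>)"
| Load: "run inp (x ::= MEM[a]) s 1 (Suc (aval a (regs s)))
    (s\<lparr>regs := (regs s)(x := mem s (aval a (regs s)))\<rparr>)"
| Store: "run inp (MEM[a] ::= b) s 1 (Suc (aval a (regs s)))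
    (s\<lparr>mem := (mem s)(aval a (regs s) := aval b (regs s))\<rparr>)"
| Seq: "run inp c\<^sub>1 s t\<^sub>1 m\<^sub>1 s' \<Longrightarrow> run inp c\<^sub>2 s' t\<^sub>2 m\<^sub>2 s'' \<Longrightarrow>
    run inp (c\<^sub>1;; c\<^sub>2) s (t\<^sub>1 + t\<^sub>2) (max m\<^sub>1 m\<^sub>2) s''"
| IfTrue: "bval b (regs s) \<Longrightarrow> run inp c\<^sub>1 s t m s' \<Longrightarrow>
    run inp (IF b THEN c\<^sub>1 ELSE c\<^sub>2) s (Suc t) m s'"
| IfFalse: "\<not> bval b (regs s) \<Longrightarrow> run inp c\<^sub>2 s t m s' \<Longrightarrow>
    run inp (IF b THEN c\<^sub>1 ELSE c\<^sub>2) s (Suc t) m s'"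
| WhileFalse: "\<not> bval b (regs s) \<Longrightarrow> run inp (WHILE b DO c) s 1 0 s"
| WhileTrue: "bval b (regs s) \<Longrightarrow> run inp c s t\<^sub>1 m\<^sub>1 s' \<Longrightarrow>
    run inp (WHILE b DO c) s' t\<^sub>2 m\<^sub>2 s'' \<Longrightarrow>
    run inp (WHILE b DO c) s (Suc (t\<^sub>1 + t\<^sub>2)) (max m\<^sub>1 m\<^sub>2) s''"


section \<open>The algorithm as a program\<close>

text \<open>The input is the adjacency array of the tree, for a numbering \<open>vs\<close> of its nodes: cell \<open>0\<close> holds
  the number of nodes, and the neighbours of node \<open>i\<close> are listed from cell \<open>inp (1 + i)\<close> up to and
  excluding cell \<open>inp (2 + i)\<close>. Nodes are referred to by their position in \<open>vs\<close>.\<close>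

definition represents :: "(nat \<Rightarrow> nat) \<Rightarrow> 'a list \<Rightarrow> 'a set \<Rightarrow> 'a set set \<Rightarrow> bool" where
  "represents inp vs V E \<longleftrightarrow> is_order vs V \<and> inp 0 = length vs \<and>
     (\<forall>i<length vs.
        (\<forall>k\<in>{inp (1 + i)..<inp (2 + i)}. inp k < length vs) \<and>
        bij_betw (\<lambda>k. vs ! inp k) {inp (1 + i)..<inp (2 + i)} (nbrs E (vs ! i)))"

text \<open>Memory layout. With \<open>k\<close> the value of \<open>rK\<close>, the first \<open>3 * k\<close> cells form a table with rows
  \<open>0, \<dots>, k - 1\<close>, one for each end node of an edge in $E^2(T)$: the node, a row number and the degree of
  the node. Row \<open>j > 0\<close> also stands for an edge, namely the one joining its node to the node of the
  row it refers to. The table is followed by the entries of the list \<open>L\<close>, of \<open>2 * k\<close> cells each: the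
  characteristic vector of a set \<open>X\<close> of edges (position \<open>0\<close> is unused) and the numbers $X_v$ for the
  nodes \<open>v\<close> of the table. If $E^2(T)$ is empty, then \<open>k = 0\<close> and an entry takes no memory.\<close>

definition tab_node :: "'a list \<Rightarrow> state \<Rightarrow> nat \<Rightarrow> 'a" where
  "tab_node vs s i = vs ! mem s (3 * i)"

definition tab_edge :: "'a list \<Rightarrow> state \<Rightarrow> nat \<Rightarrow> 'a set" where
  "tab_edge vs s j = {tab_node vs s j, tab_node vs s (mem s (3 * j + 1))}"

definition edge_table :: "'a list \<Rightarrow> 'a set set \<Rightarrow> 'a set list \<Rightarrow> state \<Rightarrow> bool" where
  "edge_table vs E es s \<longleftrightarrow>
     (let k = regs s rK in
        k = (if es = [] then 0 else Suc (length es)) \<and>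
        (\<forall>i<k. mem s (3 * i) < length vs \<and> mem s (3 * i + 2) = degree E (tab_node vs s i)) \<and>
        inj_on (tab_node vs s) {..<k} \<and>
        (\<forall>j\<in>{1..<k}. mem s (3 * j + 1) < k \<and> tab_edge vs s j = es ! (j - 1)))"

definition decoded_output :: "'a list \<Rightarrow> state \<Rightarrow> 'a set set list" where
  "decoded_output vs s = (let k = regs s rK in
     map (\<lambda>l. {tab_edge vs s j | j. j \<in> {1..<k} \<and> mem s (3 * k + l * (2 * k) + j) = 1})
       [0..<regs s rLen])"

text \<open>Computing $E^2(T)$: look for a node incident to an edge of $E^2(T)$; if there is one,
  traverse breadth-first from it the subtree formed by $E^2(T)$. The table serves as the queue.\<close>

definition compute_E2 :: com where
  "compute_E2 =
    (rN ::= INP[Cn 0];;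
     rK ::= Cn 0;;
     rV ::= Cn 0;;
     WHILE Rg rV \<lless> Rg rN DO (
       rA ::= INP[Cn 1 \<oplus> Rg rV];;
       rB ::= INP[Cn 2 \<oplus> Rg rV];;
       (IF Cn 1 \<lless> Rg rB \<ominus> Rg rA THEN
          WHILE Rg rA \<lless> Rg rB DO (
            rW ::= INP[Rg rA];;
            rC ::= INP[Cn 1 \<oplus> Rg rW];;
            rD ::= INP[Cn 2 \<oplus> Rg rW];;
            (IF Cn 1 \<lless> Rg rD \<ominus> Rg rC THEN (rRoot ::= Rg rV;; rK ::= Cn 1) ELSE Skip);;
            rA ::= Rg rA \<oplus> Cn 1)
        ELSE Skip);;
       rV ::= Rg rV \<oplus> Cn 1);;
     (IF Cn 0 \<lless> Rg rK THEN (
        rA ::= INP[Cn 1 \<oplus> Rg rRoot];;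
        rB ::= INP[Cn 2 \<oplus> Rg rRoot];;
        MEM[Cn 0] ::= Rg rRoot;;
        MEM[Cn 1] ::= Cn 0;;
        MEM[Cn 2] ::= Rg rB \<ominus> Rg rA)
      ELSE Skip);;
     rI ::= Cn 0;;
     WHILE Rg rI \<lless> Rg rK DO (
       rV ::= MEM[Rg rI \<oplus> Rg rI \<oplus> Rg rI];;
       rU ::= MEM[Rg rI \<oplus> Rg rI \<oplus> Rg rI \<oplus> Cn 1];;
       rU ::= MEM[Rg rU \<oplus> Rg rU \<oplus> Rg rU];;
       rA ::= INP[Cn 1 \<oplus> Rg rV];;
       rB ::= INP[Cn 2 \<oplus> Rg rV];;
       WHILE Rg rA \<lless> Rg rB DO (
         rW ::= INP[Rg rA];;
         rC ::= INP[Cn 1 \<oplus> Rg rW];;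
         rD ::= INP[Cn 2 \<oplus> Rg rW];;
         (IF Rg rW \<noteq>\<^sub>b Rg rU \<and>\<^sub>b Cn 1 \<lless> Rg rD \<ominus> Rg rC THEN (
            MEM[Rg rK \<oplus> Rg rK \<oplus> Rg rK] ::= Rg rW;;
            MEM[Rg rK \<oplus> Rg rK \<oplus> Rg rK \<oplus> Cn 1] ::= Rg rI;;
            MEM[Rg rK \<oplus> Rg rK \<oplus> Rg rK \<oplus> Cn 2] ::= Rg rD \<ominus> Rg rC;;
            rK ::= Rg rK \<oplus> Cn 1)
          ELSE Skip);;
         rA ::= Rg rA \<oplus> Cn 1);;
       rI ::= Rg rI \<oplus> Cn 1))"

text \<open>The loop over the edges. Since \<open>X\<close> is legal, \<open>{e} \<union> X\<close> is legal if and only if the bound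
  holds at the two end nodes of \<open>e\<close>, which are in rows \<open>rA\<close> and \<open>rJ\<close>.\<close>

definition enumerate_legal :: com where
  "enumerate_legal =
    (rBase ::= Rg rK \<oplus> Rg rK \<oplus> Rg rK;;
     rWidth ::= Rg rK \<oplus> Rg rK;;
     rFree ::= Rg rBase \<oplus> Rg rWidth;;
     rP ::= Rg rBase;;
     WHILE Rg rP \<lless> Rg rFree DO (
       MEM[Rg rP] ::= Cn 0;;
       rP ::= Rg rP \<oplus> Cn 1);;
     rLen ::= Cn 1;;
     rJ ::= Cn 1;;
     WHILE Rg rJ \<lless> Rg rK DO (
       rA ::= MEM[Rg rJ \<oplus> Rg rJ \<oplus> Rg rJ \<oplus> Cn 1];;
       rDA ::= MEM[Rg rA \<oplus> Rg rA \<oplus> Rg rA \<oplus> Cn 2];;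
       rDJ ::= MEM[Rg rJ \<oplus> Rg rJ \<oplus> Rg rJ \<oplus> Cn 2];;
       rCount ::= Rg rLen;;
       rQ ::= Rg rBase;;
       rI ::= Cn 0;;
       WHILE Rg rI \<lless> Rg rCount DO (
         rX ::= MEM[Rg rQ \<oplus> Rg rK \<oplus> Rg rA];;
         rY ::= MEM[Rg rQ \<oplus> Rg rK \<oplus> Rg rJ];;
         rX ::= Rg rX \<oplus> Cn 1;;
         rY ::= Rg rY \<oplus> Cn 1;;
         (IF Rg rX \<oplus> Rg rX \<lless> Rg rDA \<oplus> Cn 1 \<and>\<^sub>b Rg rY \<oplus> Rg rY \<lless> Rg rDJ \<oplus> Cn 1 THEN (
            rP ::= Cn 0;;
            WHILE Rg rP \<lless> Rg rWidth DO (
              rZ ::= MEM[Rg rQ \<oplus> Rg rP];;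
              MEM[Rg rFree \<oplus> Rg rP] ::= Rg rZ;;
              rP ::= Rg rP \<oplus> Cn 1);;
            MEM[Rg rFree \<oplus> Rg rJ] ::= Cn 1;;
            MEM[Rg rFree \<oplus> Rg rK \<oplus> Rg rA] ::= Rg rX;;
            MEM[Rg rFree \<oplus> Rg rK \<oplus> Rg rJ] ::= Rg rY;;
            rFree ::= Rg rFree \<oplus> Rg rWidth;;
            rLen ::= Rg rLen \<oplus> Cn 1)
          ELSE Skip);;
         rQ ::= Rg rQ \<oplus> Rg rWidth;;
         rI ::= Rg rI \<oplus> Cn 1);;
       rJ ::= Rg rJ \<oplus> Cn 1))"

text \<open>The bounds are taken literally: for an empty $E^2(T)$ no memory cell may be accessed.\<close>

definition within_bounds ::
    "nat \<Rightarrow> process \<Rightarrow> 'a set \<Rightarrow> 'a set set \<Rightarrow> nat \<Rightarrow> nat \<Rightarrow> bool" where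
  "within_bounds c M V E t m \<longleftrightarrow>
     t \<le> c * (card V + card (fixed_points M V E) * card (E2 E)) \<and>
     m \<le> c * (card (E2 E) * card (fixed_points M V E))"

end

theory Submission
  imports Defs
begin

text \<open>Deleting an edge of a tree separates its end nodes, so a colouring of the rest can be flipped on
  one side to put that edge in conflict or not. Hence every edge set is the conflict set of exactly
  one colouring with prescribed value at a given node, and the fixed points are those whose conflict
  set is legal. As subsets of legal sets are legal, no entry of the list is ever discarded: each of
  the \<open>|E2|\<close> rounds visits at most \<open>|E_fix|\<close> entries in constant time, and the copying, of
  \<open>O(|E2|)\<close> steps, is charged to the new entry.

  The nodes of degree at least two induce a connected subgraph, so the traversal from one of them
  finds all of \<open>E2\<close>, and acyclicity makes the test against the parent sufficient for not visiting a
  node twice. The time is linear since the degrees add up to at most \<open>2n\<close>.\<close>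

text \<open>The selector of the record \<open>state\<close> would otherwise shadow the round of the algorithm.\<close>

hide_fact state.extend_def

section \<open>Paths and bridges\<close>

text \<open>Charging the copying to new entries needs a budget that is known before the loops start.
  It is the final length \<open>N\<close> of the abstract list: the potential holds a payment for
  each of the \<open>N - rLen\<close> entries still missing and is carried along from round to
  round. The number of fixed points replaces \<open>N\<close> only in the final estimate.

  The two machine phases meet at \<open>edge_table\<close>, which leaves the order of the edges
  open. The enumeration is thus verified for every order, and the traversal only has to supply one.

  The product bounds are delicate at the small end. Table and entries have
  \<open>k = |E2| + 1\<close> rows, so a bound linear in \<open>|E2|\<close> relies on
  \<open>|E2| \<ge> 1\<close>; for empty \<open>E2\<close> the choice \<open>k = 0\<close> makes the
  cap on addresses zero. Costs without the factor of the number of fixed points, such as that of the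
  table, are absorbed because the empty set is legal and hence a fixed point exists.\<close>

abbreviation adj :: "'a set set \<Rightarrow> ('a \<times> 'a) set" where
  "adj E \<equiv> {(x, y). {x, y} \<in> E}"

lemma rtrancl_adj_sym: "(u, v) \<in> (adj E)\<^sup>* \<Longrightarrow> (v, u) \<in> (adj E)\<^sup>*"
proof -
  have "sym ((adj E)\<^sup>*)"
    by (intro sym_rtrancl) (auto simp: sym_def insert_commute)
  then show "(u, v) \<in> (adj E)\<^sup>* \<Longrightarrow> (v, u) \<in> (adj E)\<^sup>*"
    by (auto dest: symD)
qed

text \<open>Vertices are added at the front; one that already occurs cuts the path down to the
  suffix starting there.\<close>

lemma rtrancl_adj_imp_simple_path:
  assumes "(u, w) \<in> (adj E)\<^sup>*"
  shows "\<exists>p. p \<noteq> [] \<and> hd p = u \<and> last p = w \<and> distinct p \<and> successively (\<lambda>x y. {x, y} \<in> E) p"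
  using assms
proof (induction rule: converse_rtrancl_induct)
  case base
  show ?case by (intro exI[of _ "[w]"]) auto
next
  case (step u y)
  then obtain p where p: "p \<noteq> []" "hd p = y" "last p = w" "distinct p"
    "successively (\<lambda>x y. {x, y} \<in> E) p" by auto
  show ?case
  proof (cases "u \<in> set p")
    case True
    then obtain xs ys where "p = xs @ u # ys" by (auto simp: in_set_conv_decomp)
    with p show ?thesis
      by (intro exI[of _ "u # ys"]) (auto simp: successively_append_iff)
  next
    case False
    with p step(1) show ?thesis
      by (intro exI[of _ "u # p"]) (auto simp: successively_Cons)
  qed
qed

lemma successively_imp_rtrancl_adj:
  assumes "successively (\<lambda>x y. {x, y} \<in> E) p" "p \<noteq> []"
  shows "(hd p, last p) \<in> (adj E)\<^sup>*"
  using assms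
proof (induction p)
  case (Cons a p)
  show ?case
  proof (cases "p = []")
    case False
    with Cons have "(a, hd p) \<in> adj E" "(hd p, last p) \<in> (adj E)\<^sup>*"
      by (auto simp: successively_Cons)
    with False show ?thesis by (auto intro: converse_rtrancl_into_rtrancl)
  qed auto
qed auto

text \<open>A simple path between the ends that avoids the edge would be closed to a cycle by
  it.\<close>

lemma acyclic_edge_is_bridge:
  assumes "{u, w} \<in> E" "u \<noteq> w" "\<nexists>p. cycle E p"
  shows "(u, w) \<notin> (adj (E - {{u, w}}))\<^sup>*"
proof
  assume "(u, w) \<in> (adj (E - {{u, w}}))\<^sup>*"
  from rtrancl_adj_imp_simple_path[OF this] obtain p where p: "p \<noteq> []" "hd p = u" "last p = w"
    "distinct p" "successively (\<lambda>x y. {x, y} \<in> E - {{u, w}}) p" by blast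
  \<comment> \<open>One vertex would force \<open>u = w\<close>, and with two vertices the only edge
    of the path would be the deleted one.\<close>
  have len: "length p \<ge> 3"
  proof (rule ccontr)
    assume "\<not> length p \<ge> 3"
    with p(1) consider a where "p = [a]" | a b where "p = [a, b]"
      by (cases p; cases "tl p") (auto simp: Suc_le_eq numeral_3_eq_3)
    then show False using p assms(2) by cases auto
  qed
  have "{p ! i, p ! (Suc i mod length p)} \<in> E" if "i < length p" for i
  proof (cases "Suc i < length p")
    case True
    with p(5) show ?thesis by (auto simp: successively_conv_nth)
  next
    case False
    with that have i: "i = length p - 1" "Suc i = length p" by auto
    have "p ! i = w" "p ! 0 = u"
      using p(1-3) i by (auto simp: last_conv_nth hd_conv_nth)
    then show ?thesis using assms(1) i(2) by (auto simp: insert_commute)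
  qed
  with len p(4) have "cycle E p" by (auto simp: cycle_def)
  with assms(3) show False by blast
qed

lemma cycle_mono: "cycle F p \<Longrightarrow> F \<subseteq> E \<Longrightarrow> cycle E p"
  by (auto simp: cycle_def)

section \<open>Two-colourings of forests\<close>

lemma acyclic_two_coloring:
  assumes "finite E" "\<forall>e\<in>E. \<exists>u v. u \<noteq> v \<and> e = {u, v}" "\<nexists>p. cycle E p"
  shows "\<exists>f::'a \<Rightarrow> bool. \<forall>u v. {u, v} \<in> E \<longrightarrow> (f u \<noteq> f v \<longleftrightarrow> {u, v} \<in> X)"
  using assms
proof (induction E rule: finite_induct)
  case (insert e F)
  from insert.prems(1) obtain a b where ab: "a \<noteq> b" "e = {a, b}" by (meson insertI1)
  have "\<nexists>p. cycle F p" using insert.prems(2) cycle_mono[of F _ "insert e F"] by blast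
  then have "\<exists>f::'a \<Rightarrow> bool. \<forall>u v. {u, v} \<in> F \<longrightarrow> (f u \<noteq> f v \<longleftrightarrow> {u, v} \<in> X)"
    using insert.prems(1) by (intro insert.IH) auto
  then obtain f :: "'a \<Rightarrow> bool" where "\<forall>u v. {u, v} \<in> F \<longrightarrow> (f u \<noteq> f v \<longleftrightarrow> {u, v} \<in> X)" ..
  note f = this[rule_format]
  have "(a, b) \<notin> (adj (insert e F - {{a, b}}))\<^sup>*"
    using acyclic_edge_is_bridge[of a b "insert e F"] insert.prems(2) ab by blast
  moreover have "insert e F - {{a, b}} = F" using insert.hyps ab by auto
  ultimately have br: "(a, b) \<notin> (adj F)\<^sup>*" by metis
  \<comment> \<open>The component of \<open>a\<close> is flipped exactly if \<open>f\<close> is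
    wrong on the new edge. Edges of \<open>F\<close> stay within one component, so nothing changes
    for them, while \<open>b\<close> lies outside of the flipped part.\<close>
  define g where "g x = (f x \<noteq> ((f a \<noteq> f b \<longleftrightarrow> e \<notin> X) \<and> (a, x) \<in> (adj F)\<^sup>*))" for x
  have comp: "(a, u) \<in> (adj F)\<^sup>* \<longleftrightarrow> (a, v) \<in> (adj F)\<^sup>*" if "{u, v} \<in> F" for u v
  proof -
    have "(u, v) \<in> adj F" "(v, u) \<in> adj F" using that by (simp_all add: insert_commute)
    then show ?thesis by (meson rtrancl.rtrancl_into_rtrancl)
  qed
  have "g u \<noteq> g v \<longleftrightarrow> {u, v} \<in> X" if "{u, v} \<in> insert e F" for u v
  proof (cases "{u, v} \<in> F")
    case True
    then show ?thesis using f[OF True] comp[OF True] unfolding g_def by argo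
  next
    case False
    with that have "{u, v} = e" by auto
    with ab have "u = a \<and> v = b \<or> u = b \<and> v = a" by (auto simp: doubleton_eq_iff)
    moreover have "g a \<noteq> g b \<longleftrightarrow> e \<in> X" using br unfolding g_def by blast
    ultimately show ?thesis unfolding \<open>{u, v} = e\<close> by (elim disjE conjE) blast+
  qed
  then show ?case by (intro exI[of _ g]) simp
qed simp

lemma E2_subset: "E2 E \<subseteq> E"
  by (auto simp: E2_def)

lemma legal_list_snoc:
  "legal_list V E (es @ [e]) =
    legal_list V E es @ filter (legal V E) (map (insert e) (legal_list V E es))"
  by (simp add: legal_list_def Defs.extend_def)

text \<open>Rounds only append, so the final length bounds every intermediate one; time and memory
  accounts rest on this.\<close>

lemma length_legal_list_append: "length (legal_list V E xs) \<le> length (legal_list V E (xs @ ys))"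
proof (induction ys rule: rev_induct)
  case (snoc y ys)
  then show ?case using legal_list_snoc[of V E "xs @ ys" y] by simp
qed simp

section \<open>Degrees in a tree and its subtree of inner edges\<close>

context
  fixes V :: "'a set" and E :: "'a set set"
  assumes tree: "tree V E"
begin

lemma tree_finite: "finite V" "finite E"
proof -
  show f: "finite V" using tree by (auto simp: tree_def simple_graph_def)
  have "E \<subseteq> Pow V" using tree by (auto simp: tree_def simple_graph_def)
  with f show "finite E" by (meson finite_Pow_iff finite_subset)
qed

lemma tree_acyclic: "\<nexists>p. cycle E p" and tree_nonempty: "V \<noteq> {}"
  using tree by (auto simp: tree_def)

lemma edgeE:
  assumes "e \<in> E" obtains u v where "u \<noteq> v" "e = {u, v}" "u \<in> V" "v \<in> V"
proof -
  have "E \<subseteq> {{u, v} | u v. u \<in> V \<and> v \<in> V \<and> u \<noteq> v}"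
    using tree by (simp add: tree_def simple_graph_def)
  with assms that show thesis by blast
qed

lemma edge_props: "{u, v} \<in> E \<Longrightarrow> u \<noteq> v" "{u, v} \<in> E \<Longrightarrow> u \<in> V" "{u, v} \<in> E \<Longrightarrow> v \<in> V"
  by (erule edgeE; auto simp: doubleton_eq_iff)+

lemma edge_card: "e \<in> E \<Longrightarrow> card e = 2"
  by (erule edgeE) auto

lemma tree_two_coloring: "\<exists>f::'a \<Rightarrow> bool. \<forall>u v. {u, v} \<in> E \<longrightarrow> (f u \<noteq> f v \<longleftrightarrow> {u, v} \<in> X)"
  using acyclic_two_coloring[OF tree_finite(2) _ tree_acyclic] by (metis edgeE)

text \<open>A forest has at least as many vertex subsets as edge subsets, since every edge subset is a cut.\<close>

lemma card_edges_le: "card E \<le> card V"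
proof -
  define cut where "cut S = {e \<in> E. \<exists>u\<in>e. \<exists>v\<in>e. u \<in> S \<and> v \<notin> S}" for S
  have "Pow E \<subseteq> cut ` Pow V"
  proof
    fix X assume "X \<in> Pow E"
    obtain f :: "'a \<Rightarrow> bool" where "\<forall>u v. {u, v} \<in> E \<longrightarrow> (f u \<noteq> f v \<longleftrightarrow> {u, v} \<in> X)"
      using tree_two_coloring ..
    note f = this[rule_format]
    have "e \<in> X \<longleftrightarrow> e \<in> cut {v \<in> V. f v}" if "e \<in> E" for e
      using that
    proof (rule edgeE)
      fix u v assume "u \<noteq> v" "e = {u, v}" "u \<in> V" "v \<in> V"
      with that have "e \<in> cut {v \<in> V. f v} \<longleftrightarrow> f u \<noteq> f v" by (auto simp: cut_def)
      also have "\<dots> \<longleftrightarrow> e \<in> X" using f that \<open>e = {u, v}\<close> by metis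
      finally show ?thesis by blast
    qed
    then have "X = cut {v \<in> V. f v}" using \<open>X \<in> Pow E\<close> by (auto simp: cut_def)
    then show "X \<in> cut ` Pow V" by blast
  qed
  then have "card (Pow E) \<le> card (cut ` Pow V)"
    using tree_finite by (intro card_mono) auto
  also have "\<dots> \<le> card (Pow V)" using tree_finite by (intro card_image_le) auto
  finally show ?thesis by (simp add: card_Pow tree_finite)
qed

lemma sum_degree_le: "(\<Sum>v\<in>V. degree E v) \<le> 2 * card V"
proof -
  have "{v \<in> V. v \<in> e} = e" if "e \<in> E" for e using that by (rule edgeE) auto
  then have "(\<Sum>v\<in>V. card {e \<in> E. v \<in> e}) = 2 * card E"
    by (intro sum_multicount tree_finite) (auto simp: edge_card)
  then show ?thesis using card_edges_le by (simp add: incidence_def)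
qed

lemma finite_E2: "finite (E2 E)"
  using tree_finite finite_subset[OF E2_subset] by blast

lemma E2_pair_iff: "{u, v} \<in> E2 E \<longleftrightarrow> {u, v} \<in> E \<and> degree E u \<ge> 2 \<and> degree E v \<ge> 2"
  by (auto simp: E2_def)

text \<open>Trades edges at \<open>v\<close> for neighbours; the predicate \<open>P\<close> covers
  the degree and the incidence of a conflict set alike.\<close>

lemma card_incident:
  "card {e \<in> E. v \<in> e \<and> P e} = card {w \<in> nbrs E v. P {v, w}}"
proof (rule bij_betw_same_card[symmetric, of "\<lambda>w. {v, w}"])
  show "bij_betw (\<lambda>w. {v, w}) {w \<in> nbrs E v. P {v, w}} {e \<in> E. v \<in> e \<and> P e}"
    unfolding bij_betw_def
  proof
    show "inj_on (\<lambda>w. {v, w}) {w \<in> nbrs E v. P {v, w}}"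
      by (auto simp: inj_on_def doubleton_eq_iff)
    show "(\<lambda>w. {v, w}) ` {w \<in> nbrs E v. P {v, w}} = {e \<in> E. v \<in> e \<and> P e}"
      proof (intro equalityI subsetI)
      fix e assume "e \<in> {e \<in> E. v \<in> e \<and> P e}"
      then have e: "e \<in> E" "v \<in> e" "P e" by auto
      then obtain w where "e = {v, w}" by (metis edgeE insertE insert_commute singletonD)
      with e show "e \<in> (\<lambda>w. {v, w}) ` {w \<in> nbrs E v. P {v, w}}" by (auto simp: nbrs_def)
    qed (auto simp: nbrs_def)
  qed
qed

lemma degree_eq_card_nbrs: "degree E v = card (nbrs E v)"
  using card_incident[of v "\<lambda>_. True"] by (simp add: incidence_def)

lemma nbrs_subset: "nbrs E v \<subseteq> V"
  by (auto simp: nbrs_def edge_props)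

lemma finite_nbrs: "finite (nbrs E v)"
  using nbrs_subset tree_finite finite_subset by blast

lemma degree_ge2I:
  assumes "{v, x} \<in> E" "{v, y} \<in> E" "x \<noteq> y"
  shows "degree E v \<ge> 2"
proof -
  have "card {x, y} \<le> card (nbrs E v)"
    using assms finite_nbrs by (intro card_mono) (auto simp: nbrs_def)
  with assms show ?thesis by (simp add: degree_eq_card_nbrs)
qed

text \<open>The inner vertices of a simple path have degree at least two, so a path in \<open>E\<close> between
  two end nodes of edges in \<open>E2 E\<close> stays in \<open>E2 E\<close>.\<close>

lemma E2_connected:
  assumes "u \<in> V" "v \<in> V" "degree E u \<ge> 2" "degree E v \<ge> 2"
  shows "(u, v) \<in> (adj (E2 E))\<^sup>*"
proof -
  have "(u, v) \<in> (adj E)\<^sup>*" using assms tree by (auto simp: tree_def connected_graph_def)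
  from rtrancl_adj_imp_simple_path[OF this] obtain p where p: "p \<noteq> []" "hd p = u" "last p = v"
    "distinct p" "successively (\<lambda>x y. {x, y} \<in> E) p" by blast
  note ed = p(5)[unfolded successively_conv_nth, rule_format]
  have deg: "degree E (p ! i) \<ge> 2" if "i < length p" for i
  proof -
    have "i = 0 \<or> i = length p - 1 \<or> (\<exists>j. i = Suc j \<and> Suc i < length p)"
      using that by (cases i) auto
    then consider "i = 0" | "i = length p - 1" | j where "i = Suc j" "Suc i < length p" by blast
    then show ?thesis
    proof cases
      case 1
      then show ?thesis using p assms by (simp add: hd_conv_nth)
    next
      case 2
      then show ?thesis using p assms by (simp add: last_conv_nth)
    next
      case 3
      have "{p ! j, p ! i} \<in> E" "{p ! i, p ! Suc i} \<in> E" using 3 ed[of j] ed[of i] by auto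
      moreover have "p ! j \<noteq> p ! Suc i" using p(4) 3 by (simp add: nth_eq_iff_index_eq)
      ultimately show ?thesis by (intro degree_ge2I[of _ "p ! j" "p ! Suc i"]) (auto simp: insert_commute)
    qed
  qed
  have "successively (\<lambda>x y. {x, y} \<in> E2 E) p"
    using ed deg by (auto simp: successively_conv_nth E2_pair_iff)
  from successively_imp_rtrancl_adj[OF this p(1)] p show ?thesis by simp
qed

section \<open>Fixed points and legal sets\<close>

lemma conflict_edges_subset: "conflict_edges M E c \<subseteq> E"
  by (cases M) auto

text \<open>Folding the process into the equivalence with \<open>M = Minority\<close> lets the
  bijection below be proved for both processes at once.\<close>

lemma conflict_edges_pair_iff:
  assumes "{u, v} \<in> E"
  shows "{u, v} \<in> conflict_edges M E c \<longleftrightarrow> (c u = c v \<longleftrightarrow> M = Minority)"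
  using assms by (cases M) auto

lemma legal_iff:
  "legal V E X \<longleftrightarrow> X \<subseteq> E2 E \<and> (\<forall>v\<in>V. 2 * incidence X v \<le> degree E v)"
proof -
  have "real a \<le> real b / 2 \<longleftrightarrow> 2 * a \<le> b" for a b :: nat
    by linarith
  then show ?thesis by (simp add: legal_def)
qed

lemma incidence_mono: "X \<subseteq> Y \<Longrightarrow> finite Y \<Longrightarrow> incidence X v \<le> incidence Y v"
  unfolding incidence_def by (intro card_mono) auto

lemma legal_subset: "legal V E Y \<Longrightarrow> X \<subseteq> Y \<Longrightarrow> legal V E X"
  using incidence_mono finite_subset[OF _ finite_E2] unfolding legal_iff
  by (meson mult_le_mono2 order_trans subset_trans)

text \<open>An edge at a leaf cannot be in conflict: half of the leaf's degree is less than one.\<close>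

lemma legal_iff_subset_edges:
  "legal V E X \<longleftrightarrow> X \<subseteq> E \<and> (\<forall>v\<in>V. 2 * incidence X v \<le> degree E v)"
proof
  assume X: "X \<subseteq> E \<and> (\<forall>v\<in>V. 2 * incidence X v \<le> degree E v)"
  have "degree E v \<ge> 2" if "e \<in> X" "v \<in> e" for e v
  proof -
    have "v \<in> V" using that X by (auto elim!: edgeE)
    moreover have "incidence X v > 0"
      using that X tree_finite finite_subset[of X E] by (auto simp: incidence_def card_gt_0_iff)
    ultimately show ?thesis using X by fastforce
  qed
  with X show "legal V E X" by (auto simp: legal_iff E2_def)
next
  assume "legal V E X"
  then show "X \<subseteq> E \<and> (\<forall>v\<in>V. 2 * incidence X v \<le> degree E v)"
    using E2_subset unfolding legal_iff by blast
qed

lemma incidence_conflict_edges: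
  "incidence (conflict_edges M E c) v = card {w \<in> nbrs E v. c v = c w \<longleftrightarrow> M = Minority}"
proof -
  have "{e \<in> conflict_edges M E c. v \<in> e} = {e \<in> E. v \<in> e \<and> e \<in> conflict_edges M E c}"
    using conflict_edges_subset by auto
  then have "incidence (conflict_edges M E c) v
      = card {w \<in> nbrs E v. {v, w} \<in> conflict_edges M E c}"
    by (simp add: incidence_def card_incident)
  also have "{w \<in> nbrs E v. {v, w} \<in> conflict_edges M E c}
      = {w \<in> nbrs E v. c v = c w \<longleftrightarrow> M = Minority}"
    using conflict_edges_pair_iff by (auto simp: nbrs_def)
  finally show ?thesis .
qed

text \<open>The neighbours split into those that agree with \<open>v\<close> and those that do not.
  The conflicting class is no larger than the other one exactly if its double is at most the degree,
  which is the legality bound at \<open>v\<close>.\<close>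

lemma apply_process_eq_iff:
  assumes c: "c \<in> V \<rightarrow>\<^sub>E {0, 1}" and v: "v \<in> V"
  shows "apply_process M V E c v = c v \<longleftrightarrow>
    2 * incidence (conflict_edges M E c) v \<le> degree E v"
proof -
  have c01: "c w = 0 \<or> c w = 1" if "w \<in> V" for w
    using PiE_mem[OF c that] by simp
  define S where "S = {w \<in> nbrs E v. c v = c w}"
  define D where "D = {w \<in> nbrs E v. c v \<noteq> c w}"
  \<comment> \<open>Both colours lie in {0, 1}, so the truncated \<open>1 - c v\<close> is the other
    colour.\<close>
  have "c w = 1 - c v \<longleftrightarrow> c v \<noteq> c w" if "w \<in> nbrs E v" for w
  proof -
    have "w \<in> V" using that nbrs_subset by blast
    from c01[OF this] c01[OF v] show ?thesis by (elim disjE) simp_all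
  qed
  then have col: "color_nbrs E c (c v) v = S" "color_nbrs E c (1 - c v) v = D"
    unfolding color_nbrs_def S_def D_def by (blast intro: sym, blast)
  have "finite S" "finite D" "S \<inter> D = {}" using finite_nbrs by (auto simp: S_def D_def)
  then have "card (S \<union> D) = card S + card D" by (rule card_Un_disjoint)
  moreover have "S \<union> D = nbrs E v" by (auto simp: S_def D_def)
  ultimately have deg: "degree E v = card S + card D" by (simp add: degree_eq_card_nbrs)
  have inc: "incidence (conflict_edges Minority E c) v = card S"
    "incidence (conflict_edges Majority E c) v = card D"
    by (simp_all add: incidence_conflict_edges S_def D_def del: conflict_edges.simps)
  have "1 - c v \<noteq> c v" using c01[OF v] by auto
  then have if_eq: "(if P then c v else 1 - c v) = c v \<longleftrightarrow> P" for P by simp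
  show ?thesis
    by (cases M) (simp_all add: v deg col inc if_eq del: conflict_edges.simps One_nat_def)
qed

lemma fixed_points_iff:
  "c \<in> fixed_points M V E \<longleftrightarrow> c \<in> V \<rightarrow>\<^sub>E {0, 1} \<and> legal V E (conflict_edges M E c)"
proof (cases "c \<in> V \<rightarrow>\<^sub>E {0, 1}")
  case True
  have "apply_process M V E c = c \<longleftrightarrow> (\<forall>v\<in>V. apply_process M V E c v = c v)"
  proof
    assume "\<forall>v\<in>V. apply_process M V E c v = c v"
    then show "apply_process M V E c = c"
      using True by (intro extensionalityI[of _ V]) (cases M; auto simp: PiE_def)+
  qed simp
  then show ?thesis
    using True conflict_edges_subset
    by (auto simp: fixed_points_def legal_iff_subset_edges apply_process_eq_iff)
qed (auto simp: fixed_points_def)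

lemma finite_fixed_points: "finite (fixed_points M V E)"
proof -
  have "finite (V \<rightarrow>\<^sub>E {0, 1::nat})" using tree_finite by (intro finite_PiE) auto
  then show ?thesis by (auto simp: fixed_points_def)
qed

lemma bij_betw_conflict_edges:
  assumes v: "v \<in> V"
  shows "bij_betw (conflict_edges M E) {f \<in> fixed_points M V E. f v = 0} (E_fix V E)"
  unfolding bij_betw_def
proof
  show "inj_on (conflict_edges M E) {f \<in> fixed_points M V E. f v = 0}"
  proof (rule inj_onI, clarsimp)
    fix f g
    assume f: "f \<in> fixed_points M V E" "f v = 0" and g: "g \<in> fixed_points M V E" "g v = 0"
      and eq: "conflict_edges M E f = conflict_edges M E g"
    have fg: "f \<in> V \<rightarrow>\<^sub>E {0, 1}" "g \<in> V \<rightarrow>\<^sub>E {0, 1}" using f g by (auto simp: fixed_points_def)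
    have val: "h w = 0 \<or> h w = 1" if "h \<in> V \<rightarrow>\<^sub>E {0, 1}" "w \<in> V" for h :: "'a \<Rightarrow> nat" and w
      using PiE_mem[OF that] by simp
    have "f w = g w" if "w \<in> V" for w
    proof -
      \<comment> \<open>Equal conflict sets tell for each edge whether its ends agree, so equality
        of \<open>f\<close> and \<open>g\<close> spreads from \<open>v\<close> along paths.\<close>
      have "(v, w) \<in> (adj E)\<^sup>*"
        using v that tree by (auto simp: tree_def connected_graph_def)
      then show ?thesis
      proof (induction rule: rtrancl_induct)
        case base
        show ?case using f g by simp
      next
        case (step y z)
        then have e: "{y, z} \<in> E" by simp
        then have "f y = f z \<longleftrightarrow> g y = g z"
          using conflict_edges_pair_iff[OF e, of M f] conflict_edges_pair_iff[OF e, of M g] eq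
          by auto
        with val[OF fg(1)] val[OF fg(2)] edge_props[OF e] step.IH show ?case by metis
      qed
    qed
    then show "f = g" using fg by (intro extensionalityI[of _ V]) (auto simp: PiE_def)
  qed
  show "conflict_edges M E ` {f \<in> fixed_points M V E. f v = 0} = E_fix V E"
  proof
    show "conflict_edges M E ` {f \<in> fixed_points M V E. f v = 0} \<subseteq> E_fix V E"
      by (auto simp: E_fix_def fixed_points_iff)
    show "E_fix V E \<subseteq> conflict_edges M E ` {f \<in> fixed_points M V E. f v = 0}"
    proof
      fix X assume "X \<in> E_fix V E"
      then have X: "legal V E X" "X \<subseteq> E" by (auto simp: E_fix_def legal_iff_subset_edges)
      \<comment> \<open>The chosen set is that of the bichromatic edges; conflicts under
        \<open>Minority\<close> are monochromatic, hence the complement there.\<close>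
      obtain h :: "'a \<Rightarrow> bool" where
          "\<forall>u w. {u, w} \<in> E \<longrightarrow> (h u \<noteq> h w \<longleftrightarrow> {u, w} \<in> (if M = Minority then E - X else X))"
        using tree_two_coloring ..
      note h = this[rule_format]
      \<comment> \<open>Comparison with \<open>h v\<close> swaps the colours if necessary: the
        bichromatic edges stay the same and \<open>v\<close> receives 0.\<close>
      define f :: "'a \<Rightarrow> nat" where "f = (\<lambda>w\<in>V. if h w = h v then 0 else 1)"
      have "conflict_edges M E f = X"
      proof -
        have "e \<in> conflict_edges M E f \<longleftrightarrow> e \<in> X" if "e \<in> E" for e
          using that
        proof (rule edgeE)
          fix a b assume ab: "a \<noteq> b" "e = {a, b}" "a \<in> V" "b \<in> V"
          with that have e: "{a, b} \<in> E" by simp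
          define same where "same \<longleftrightarrow> h a = h b"
          have "f a = f b \<longleftrightarrow> same" using ab by (auto simp: f_def same_def)
          then have "e \<in> conflict_edges M E f \<longleftrightarrow> (same \<longleftrightarrow> M = Minority)"
            using conflict_edges_pair_iff[OF e, of M f] ab(2) by simp
          moreover have "\<not> same \<longleftrightarrow> e \<in> (if M = Minority then E - X else X)"
            using h[OF e] unfolding ab(2) same_def .
          ultimately show ?thesis using that by (auto split: if_splits)
        qed
        then show ?thesis using X(2) conflict_edges_subset by blast
      qed
      then have X_eq: "X = conflict_edges M E f" by simp
      have "f \<in> V \<rightarrow>\<^sub>E {0, 1}" "f v = 0" using v by (auto simp: f_def)
      then have "f \<in> {f \<in> fixed_points M V E. f v = 0}"
        using X(1) unfolding X_eq by (simp add: fixed_points_iff)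
      with X_eq show "X \<in> conflict_edges M E ` {f \<in> fixed_points M V E. f v = 0}"
        by (rule image_eqI)
    qed
  qed
qed

lemma card_E_fix_le: "card (E_fix V E) \<le> card (fixed_points M V E)"
proof -
  obtain v where "v \<in> V" using tree_nonempty by blast
  then have "card (E_fix V E) = card {f \<in> fixed_points M V E. f v = 0}"
    by (intro bij_betw_same_card[symmetric, OF bij_betw_conflict_edges])
  also have "\<dots> \<le> card (fixed_points M V E)"
    using finite_fixed_points by (intro card_mono) auto
  finally show ?thesis .
qed

section \<open>The list of legal sets\<close>

text \<open>Induction over the processed prefix. A legal set containing the last edge
  \<open>e\<close> stays legal without it and so arises from an entry already listed; sets with and
  without \<open>e\<close> never coincide.\<close>

lemma legal_list_props:
  assumes "distinct es" "set es \<subseteq> E2 E"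
  shows "distinct (legal_list V E es) \<and> set (legal_list V E es) = {X. legal V E X \<and> X \<subseteq> set es}"
  using assms
proof (induction es rule: rev_induct)
  case Nil
  show ?case by (auto simp: legal_list_def legal_iff incidence_def)
next
  case (snoc e es)
  let ?L = "legal_list V E es"
  from snoc have e: "e \<notin> set es" "e \<in> E2 E" and d: "distinct ?L"
    and s: "set ?L = {X. legal V E X \<and> X \<subseteq> set es}" by auto
  have "inj_on (insert e) (set ?L)" using e by (auto simp: s inj_on_def)
  then have "distinct (legal_list V E (es @ [e]))"
    using d e by (auto simp: legal_list_snoc distinct_map s intro!: distinct_filter)
  moreover have "set (legal_list V E (es @ [e])) = {X. legal V E X \<and> X \<subseteq> set (es @ [e])}"
  proof (intro set_eqI iffI)
    fix X assume "X \<in> {X. legal V E X \<and> X \<subseteq> set (es @ [e])}"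
    then have X: "legal V E X" "X \<subseteq> insert e (set es)" by auto
    show "X \<in> set (legal_list V E (es @ [e]))"
    proof (cases "e \<in> X")
      case True
      have "X - {e} \<in> set ?L" using X legal_subset[of X "X - {e}"] by (auto simp: s)
      then have "insert e (X - {e}) \<in> insert e ` set ?L" by (rule imageI)
      then show ?thesis using X(1) True by (simp add: legal_list_snoc insert_absorb)
    next
      case False
      with X have "X \<in> set ?L" by (auto simp: s)
      then show ?thesis by (auto simp: legal_list_snoc)
    qed
  qed (auto simp: legal_list_snoc s)
  ultimately show ?case by blast
qed

lemma set_legal_list:
  assumes "is_order es (E2 E)"
  shows "distinct (legal_list V E es)" "set (legal_list V E es) = E_fix V E"
  using legal_list_props[of es] assms unfolding is_order_def E_fix_def legal_iff by auto

lemma length_legal_list_le: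
  assumes "is_order es (E2 E)"
  shows "length (legal_list V E es) \<le> card (fixed_points M V E)"
  using set_legal_list[OF assms] card_E_fix_le[of M] by (metis distinct_card)

end

section \<open>Total correctness with resource bounds\<close>

text \<open>A weakest precondition with resources. The memory cap is a fixed parameter, because
  sequencing takes maxima, while the time is handed to the postcondition, because sequencing
  adds.\<close>

definition terminates ::
    "(nat \<Rightarrow> nat) \<Rightarrow> com \<Rightarrow> state \<Rightarrow> nat \<Rightarrow> (nat \<Rightarrow> state \<Rightarrow> bool) \<Rightarrow> bool" where
  "terminates inp c s M Q \<longleftrightarrow> (\<exists>t m s'. run inp c s t m s' \<and> m \<le> M \<and> Q t s')"

lemma terminates_mono:
  "terminates inp c s M Q \<Longrightarrow> (\<And>t s'. Q t s' \<Longrightarrow> Q' t s') \<Longrightarrow> terminates inp c s M Q'"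
  unfolding terminates_def by blast

abbreviation conf :: "(reg \<Rightarrow> nat) \<Rightarrow> (nat \<Rightarrow> nat) \<Rightarrow> state" where
  "conf r m \<equiv> \<lparr>regs = r, mem = m\<rparr>"

text \<open>In the rules for the basic commands, the evaluated expressions are variables with a defining
  premise, so that the simplifier can normalize a value before it is substituted.\<close>

lemma terminates_Skip: "Q 1 s \<Longrightarrow> terminates inp Skip s M Q"
  unfolding terminates_def by (blast intro: run.Skip)

lemma terminates_Assign:
  assumes "aval a r = v" "Q 1 (conf (r(x := v)) m)"
  shows "terminates inp (x ::= a) (conf r m) M Q"
  using assms run.Assign[of inp x a "conf r m"] unfolding terminates_def
  by (intro exI[of _ 1] exI[of _ 0] exI[of _ "conf (r(x := v)) m"]) simp

lemma terminates_Input: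
  assumes "aval a r = v" "Q 1 (conf (r(x := inp v)) m)"
  shows "terminates inp (x ::= INP[a]) (conf r m) M Q"
  using assms run.Input[of inp x a "conf r m"] unfolding terminates_def
  by (intro exI[of _ 1] exI[of _ 0] exI[of _ "conf (r(x := inp v)) m"]) simp

lemma terminates_Load:
  assumes "aval a r = v" "m v = w" "Q 1 (conf (r(x := w)) m)" "v < M"
  shows "terminates inp (x ::= MEM[a]) (conf r m) M Q"
  using assms run.Load[of inp x a "conf r m"] unfolding terminates_def
  by (intro exI[of _ 1] exI[of _ "Suc v"] exI[of _ "conf (r(x := w)) m"]) simp

lemma terminates_Store:
  assumes "aval a r = v" "aval b r = w" "Q 1 (conf r (m(v := w)))" "v < M"
  shows "terminates inp (MEM[a] ::= b) (conf r m) M Q"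
  using assms run.Store[of inp a b "conf r m"] unfolding terminates_def
  by (intro exI[of _ 1] exI[of _ "Suc v"] exI[of _ "conf r (m(v := w))"]) simp

lemma terminates_Seq:
  assumes "terminates inp c1 s M (\<lambda>t s'. terminates inp c2 s' M (\<lambda>t'. Q (t + t')))"
  shows "terminates inp (c1;; c2) s M Q"
  using assms unfolding terminates_def by (meson max.boundedI run.Seq)

lemma terminates_Cond:
  assumes "bval b r \<Longrightarrow> terminates inp c1 (conf r m) M (\<lambda>t. Q (Suc t))"
    and "\<not> bval b r \<Longrightarrow> terminates inp c2 (conf r m) M (\<lambda>t. Q (Suc t))"
  shows "terminates inp (IF b THEN c1 ELSE c2) (conf r m) M Q"
proof (cases "bval b r")
  case True
  then have "bval b (regs (conf r m))" by simp
  with assms(1)[OF True] show ?thesis unfolding terminates_def by (meson run.IfTrue)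
next
  case False
  then have "\<not> bval b (regs (conf r m))" by simp
  with assms(2)[OF False] show ?thesis unfolding terminates_def by (meson run.IfFalse)
qed

lemmas terminates_basic = terminates_Skip terminates_Assign terminates_Input terminates_Load
  terminates_Store terminates_Seq terminates_Cond

text \<open>The potential \<open>p\<close> pays for the remaining iterations; as every iteration takes time, it also
  serves as the termination measure.\<close>

lemma terminates_While:
  fixes p :: "(reg \<Rightarrow> nat) \<Rightarrow> (nat \<Rightarrow> nat) \<Rightarrow> nat"
  assumes "I r m"
    and body: "\<And>r m. I r m \<Longrightarrow> bval b r \<Longrightarrow> terminates inp c (conf r m) M
      (\<lambda>t s'. I (regs s') (mem s') \<and> Suc t + p (regs s') (mem s') \<le> p r m)"
    and post: "\<And>t r' m'. I r' m' \<Longrightarrow> \<not> bval b r' \<Longrightarrow> t + p r' m' \<le> Suc (p r m) \<Longrightarrow> Q t (conf r' m')"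
  shows "terminates inp (WHILE b DO c) (conf r m) M Q"
proof -
  \<comment> \<open>The \<open>Suc\<close> on the right pays for the final, failing test; successful
    tests are paid by the \<open>Suc\<close> in the bound of the body.\<close>
  have "terminates inp (WHILE b DO c) (conf r m) M (\<lambda>t s'. I (regs s') (mem s') \<and>
      \<not> bval b (regs s') \<and> t + p (regs s') (mem s') \<le> Suc (p r m))"
    using assms(1)
  proof (induction "p r m" arbitrary: r m rule: less_induct)
    case less
    show ?case
    proof (cases "bval b r")
      case True
      then have b: "bval b (regs (conf r m))" by simp
      from body[OF less.prems True] obtain t n r1 m1 where 1: "run inp c (conf r m) t n (conf r1 m1)"
        "n \<le> M" "I r1 m1" "Suc t + p r1 m1 \<le> p r m"
        unfolding terminates_def by (metis state.surjective old.unit.exhaust)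
      from less.hyps[OF _ 1(3)] 1(4) obtain t' n' s2 where
        2: "run inp (WHILE b DO c) (conf r1 m1) t' n' s2" "n' \<le> M" "I (regs s2) (mem s2)"
          "\<not> bval b (regs s2)" "t' + p (regs s2) (mem s2) \<le> Suc (p r1 m1)"
        unfolding terminates_def by force
      from run.WhileTrue[OF b 1(1) 2(1)] show ?thesis
        using 1 2 unfolding terminates_def
        by (intro exI[of _ "Suc (t + t')"] exI[of _ "max n n'"] exI[of _ s2]) auto
    next
      case False
      then have "\<not> bval b (regs (conf r m))" by simp
      from run.WhileFalse[OF this] less.prems False show ?thesis unfolding terminates_def
        by (intro exI[of _ 1] exI[of _ 0] exI[of _ "conf r m"]) auto
    qed
  qed
  then show ?thesis
  proof (rule terminates_mono)
    fix t and s' :: state assume *: "I (regs s') (mem s') \<and> \<not> bval b (regs s') \<and>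
      t + p (regs s') (mem s') \<le> Suc (p r m)"
    obtain r' m' where "s' = conf r' m'" by (cases s') auto
    with * post[of r' m' t] show "Q t s'" by simp
  qed
qed

section \<open>Enumerating the legal sets\<close>

lemma incidence_insert:
  assumes "finite X" "e \<notin> X"
  shows "incidence (insert e X) v = incidence X v + (if v \<in> e then 1 else 0)"
proof -
  have "{f \<in> insert e X. v \<in> f} = (if v \<in> e then insert e {f \<in> X. v \<in> f} else {f \<in> X. v \<in> f})"
    by auto
  with assms show ?thesis by (simp add: incidence_def)
qed

lemma legal_insert_iff:
  assumes "tree V E" "legal V E X" "{a, b} \<in> E2 E" "{a, b} \<notin> X"
  shows "legal V E (insert {a, b} X) \<longleftrightarrow>
    2 * (incidence X a + 1) \<le> degree E a \<and> 2 * (incidence X b + 1) \<le> degree E b"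
proof -
  note iff = legal_iff[OF assms(1)]
  have X: "X \<subseteq> E2 E" "\<And>v. v \<in> V \<Longrightarrow> 2 * incidence X v \<le> degree E v"
    using assms(2) by (auto simp: iff)
  have fin: "finite X" using X(1) finite_E2[OF assms(1)] finite_subset by blast
  have "{a, b} \<in> E" using assms(3) E2_subset[of E] by blast
  then have ab: "a \<in> V" "b \<in> V" by (auto dest: edge_props[OF assms(1)])
  show ?thesis
    using X assms(3) ab by (auto simp: iff incidence_insert[OF fin assms(4)])
qed

section \<open>The loops of the enumeration as separate commands\<close>

definition clear_loop :: com where
  "clear_loop = (WHILE Rg rP \<lless> Rg rFree DO (
     MEM[Rg rP] ::= Cn 0;;
     rP ::= Rg rP \<oplus> Cn 1))"

definition copy_loop :: com where
  "copy_loop = (WHILE Rg rP \<lless> Rg rWidth DO (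
     rZ ::= MEM[Rg rQ \<oplus> Rg rP];;
     MEM[Rg rFree \<oplus> Rg rP] ::= Rg rZ;;
     rP ::= Rg rP \<oplus> Cn 1))"

definition entry_loop :: com where
  "entry_loop = (WHILE Rg rI \<lless> Rg rCount DO (
     rX ::= MEM[Rg rQ \<oplus> Rg rK \<oplus> Rg rA];;
     rY ::= MEM[Rg rQ \<oplus> Rg rK \<oplus> Rg rJ];;
     rX ::= Rg rX \<oplus> Cn 1;;
     rY ::= Rg rY \<oplus> Cn 1;;
     (IF Rg rX \<oplus> Rg rX \<lless> Rg rDA \<oplus> Cn 1 \<and>\<^sub>b Rg rY \<oplus> Rg rY \<lless> Rg rDJ \<oplus> Cn 1 THEN (
        rP ::= Cn 0;;
        copy_loop;;
        MEM[Rg rFree \<oplus> Rg rJ] ::= Cn 1;;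
        MEM[Rg rFree \<oplus> Rg rK \<oplus> Rg rA] ::= Rg rX;;
        MEM[Rg rFree \<oplus> Rg rK \<oplus> Rg rJ] ::= Rg rY;;
        rFree ::= Rg rFree \<oplus> Rg rWidth;;
        rLen ::= Rg rLen \<oplus> Cn 1)
      ELSE Skip);;
     rQ ::= Rg rQ \<oplus> Rg rWidth;;
     rI ::= Rg rI \<oplus> Cn 1))"

definition edge_loop :: com where
  "edge_loop = (WHILE Rg rJ \<lless> Rg rK DO (
     rA ::= MEM[Rg rJ \<oplus> Rg rJ \<oplus> Rg rJ \<oplus> Cn 1];;
     rDA ::= MEM[Rg rA \<oplus> Rg rA \<oplus> Rg rA \<oplus> Cn 2];;
     rDJ ::= MEM[Rg rJ \<oplus> Rg rJ \<oplus> Rg rJ \<oplus> Cn 2];;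
     rCount ::= Rg rLen;;
     rQ ::= Rg rBase;;
     rI ::= Cn 0;;
     entry_loop;;
     rJ ::= Rg rJ \<oplus> Cn 1))"

lemma enumerate_legal_eq:
  "enumerate_legal =
    (rBase ::= Rg rK \<oplus> Rg rK \<oplus> Rg rK;;
     rWidth ::= Rg rK \<oplus> Rg rK;;
     rFree ::= Rg rBase \<oplus> Rg rWidth;;
     rP ::= Rg rBase;;
     clear_loop;;
     rLen ::= Cn 1;;
     rJ ::= Cn 1;;
     edge_loop)"
  by (simp add: enumerate_legal_def clear_loop_def copy_loop_def entry_loop_def edge_loop_def)

lemma terminates_clear_loop:
  assumes le: "r rP \<le> r rFree" "r rFree \<le> M"
    and post: "\<And>t r' m'. t \<le> Suc (3 * (r rFree - r rP)) \<Longrightarrow> \<forall>x. x \<noteq> rP \<longrightarrow> r' x = r x \<Longrightarrow>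
      m' = (\<lambda>a. if r rP \<le> a \<and> a < r rFree then 0 else m a) \<Longrightarrow> Q t (conf r' m')"
  shows "terminates inp clear_loop (conf r m) M Q"
  unfolding clear_loop_def
\<comment> \<open>Three steps per cell: the test and two commands.\<close>
proof (rule terminates_While[where p = "\<lambda>r' _. 3 * (r rFree - r' rP)" and
      I = "\<lambda>r' m'. (\<forall>x. x \<noteq> rP \<longrightarrow> r' x = r x) \<and> r rP \<le> r' rP \<and> r' rP \<le> r rFree \<and>
        m' = (\<lambda>a. if r rP \<le> a \<and> a < r' rP then 0 else m a)"], goal_cases)
  case 1
  show ?case using le by auto
next
  case (2 r' m')
  show ?case
    by ((rule terminates_basic | (simp; fail))+) (use 2 le(2) in \<open>auto simp: fun_eq_iff less_Suc_eq\<close>)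
next
  case (3 t r' m')
  then have "r' rP = r rFree" by auto
  with 3 show ?case by (intro post) auto
qed

lemma terminates_copy_loop:
  assumes le: "r rP = 0" "r rQ + r rWidth \<le> r rFree" "r rFree + r rWidth \<le> M"
    and post: "\<And>t r' m'. t \<le> Suc (4 * r rWidth) \<Longrightarrow> \<forall>x. x \<noteq> rP \<and> x \<noteq> rZ \<longrightarrow> r' x = r x \<Longrightarrow>
      m' = (\<lambda>a. if r rFree \<le> a \<and> a < r rFree + r rWidth then m (a - r rFree + r rQ) else m a) \<Longrightarrow>
      Q t (conf r' m')"
  shows "terminates inp copy_loop (conf r m) M Q"
  unfolding copy_loop_def
\<comment> \<open>Four steps per cell: the test and three commands. The source ends at or before
  \<open>rFree\<close>, so every read meets an original cell.\<close>
proof (rule terminates_While[where p = "\<lambda>r' _. 4 * (r rWidth - r' rP)" and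
      I = "\<lambda>r' m'. (\<forall>x. x \<noteq> rP \<and> x \<noteq> rZ \<longrightarrow> r' x = r x) \<and> r' rP \<le> r rWidth \<and>
        m' = (\<lambda>a. if r rFree \<le> a \<and> a < r rFree + r' rP then m (a - r rFree + r rQ) else m a)"],
      goal_cases)
  case 1
  show ?case using le by auto
next
  case (2 r' m')
  show ?case
    by ((rule terminates_basic | (simp; fail))+) (use 2 le in \<open>auto simp: fun_eq_iff less_Suc_eq add.commute\<close>)
next
  case (3 t r' m')
  then have "r' rP = r rWidth" by auto
  with 3 show ?case by (intro post) auto
qed

section \<open>The list of legal sets in memory\<close>

locale edge_list =
  fixes V :: "'a set" and E :: "'a set set" and es :: "'a set list" and k :: nat
    and node :: "nat \<Rightarrow> 'a" and m0 :: "nat \<Rightarrow> nat"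
  assumes tree: "tree V E"
    and order: "is_order es (E2 E)"
    and k_eq: "k = (if es = [] then 0 else Suc (length es))"
    and inj: "inj_on node {..<k}"
    and row_degree: "\<And>i. i < k \<Longrightarrow> m0 (3 * i + 2) = degree E (node i)"
    and row_ref: "\<And>j. 1 \<le> j \<Longrightarrow> j < k \<Longrightarrow> m0 (3 * j + 1) < k"
    and row_edge: "\<And>j. 1 \<le> j \<Longrightarrow> j < k \<Longrightarrow> {node j, node (m0 (3 * j + 1))} = es ! (j - 1)"
begin

text \<open>Read off from the memory \<open>m0\<close> at the start of the enumeration once and for
  all, since the table cells keep their contents.\<close>

definition par :: "nat \<Rightarrow> nat" where
  "par j = m0 (3 * j + 1)"

definition edge :: "nat \<Rightarrow> 'a set" where
  "edge j = es ! (j - 1)"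

lemma par_less: "1 \<le> j \<Longrightarrow> j < k \<Longrightarrow> par j < k"
  using row_ref unfolding par_def .

lemma edge_eq: "1 \<le> j \<Longrightarrow> j < k \<Longrightarrow> edge j = {node j, node (par j)}"
  using row_edge unfolding par_def edge_def by simp

text \<open>The address of entry \<open>l\<close>; at \<open>l = N\<close> it is the end of the list
  and serves as the memory cap.\<close>

definition off :: "nat \<Rightarrow> nat" where
  "off l = 3 * k + l * (2 * k)"

lemma off_0: "off 0 = 3 * k" and off_Suc: "off (Suc l) = off l + 2 * k"
  by (simp_all add: off_def)

lemma off_ge: "3 * k \<le> off l"
  by (simp add: off_def)

lemma off_mono: "l \<le> l' \<Longrightarrow> off l \<le> off l'"
  by (simp add: off_def)

lemma off_less: "l < l' \<Longrightarrow> off l + 2 * k \<le> off l'"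
  using off_mono[of "Suc l" l'] by (simp add: off_Suc)

definition holds_set :: "(nat \<Rightarrow> nat) \<Rightarrow> nat \<Rightarrow> 'a set set \<Rightarrow> bool" where
  "holds_set m p X \<longleftrightarrow>
     (\<forall>j. 1 \<le> j \<and> j < k \<longrightarrow> m (p + j) = (if edge j \<in> X then 1 else 0)) \<and>
     (\<forall>i<k. m (p + k + i) = incidence X (node i))"

definition holds_list :: "(nat \<Rightarrow> nat) \<Rightarrow> 'a set set list \<Rightarrow> bool" where
  "holds_list m L \<longleftrightarrow>
     (\<forall>a<3 * k. m a = m0 a) \<and> (\<forall>l<length L. holds_set m (off l) (L ! l))"

text \<open>Row \<open>j\<close> carries the edge at position \<open>j - 1\<close>, so this is the
  list when \<open>rJ\<close> reaches \<open>j\<close>, before that edge is tried.\<close>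

abbreviation sublist_upto :: "nat \<Rightarrow> 'a set set list" where
  "sublist_upto j \<equiv> legal_list V E (take (j - 1) es)"

abbreviation N :: nat where
  "N \<equiv> length (legal_list V E es)"

lemma es_props: "distinct es" "set es = E2 E"
  using order by (auto simp: is_order_def)

lemma edge_in_E2: "1 \<le> j \<Longrightarrow> j < k \<Longrightarrow> edge j \<in> E2 E"
  using nth_mem[of "j - 1" es] es_props(2) k_eq by (simp add: edge_def split: if_splits)

text \<open>As the order has no repetitions, earlier entries lack the edge of row \<open>j\<close>,
  and adding it raises the two counters by exactly one.\<close>

lemma sublist_upto_props:
  assumes "1 \<le> j" "j < k" "X \<in> set (sublist_upto j)"
  shows "legal V E X" "finite X" "edge j \<notin> X"
proof -
  have *: "distinct (take (j - 1) es)" "set (take (j - 1) es) \<subseteq> E2 E"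
    using es_props set_take_subset[of "j - 1" es] by auto
  have X: "legal V E X" "X \<subseteq> set (take (j - 1) es)"
    using legal_list_props[OF tree *] assms by auto
  then show "legal V E X" "finite X" using finite_subset by auto
  have "j - 1 < length es" using assms k_eq by (auto split: if_splits)
  then have "edge j \<notin> set (take (j - 1) es)"
    using es_props(1) by (auto simp: edge_def in_set_conv_nth nth_eq_iff_index_eq)
  with X show "edge j \<notin> X" by blast
qed

lemma sublist_upto_Suc:
  assumes "1 \<le> j" "j < k"
  shows "sublist_upto (Suc j) = sublist_upto j @
    filter (legal V E) (map (insert (edge j)) (sublist_upto j))"
proof -
  have "j - 1 < length es" using assms k_eq by (auto split: if_splits)
  then have "take (Suc (j - 1)) es = take (j - 1) es @ [edge j]"
    unfolding edge_def by (rule take_Suc_conv_app_nth)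
  moreover have "Suc j - 1 = Suc (j - 1)" using assms by simp
  ultimately show ?thesis by (simp only: legal_list_snoc edge_def)
qed

lemma length_sublist_upto_le: "length (sublist_upto j) \<le> N"
  using length_legal_list_append[of V E "take (j - 1) es" "drop (j - 1) es"] by simp

lemma node_mem_edge_iff:
  assumes "1 \<le> j" "j < k" "i < k"
  shows "node i \<in> edge j \<longleftrightarrow> i = j \<or> i = par j"
  using edge_eq[OF assms(1,2)] par_less[OF assms(1,2)] assms inj
  by (auto simp: inj_on_def)

text \<open>There are no loops. Consequently the two counters of a new entry are different
  cells.\<close>

lemma par_neq:
  assumes "1 \<le> j" "j < k"
  shows "par j \<noteq> j"
proof
  assume "par j = j"
  then have "edge j = {node j, node j}" using edge_eq[OF assms] by simp
  moreover have "edge j \<in> E" using edge_in_E2[OF assms] E2_subset by blast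
  ultimately have "{node j, node j} \<in> E" by simp
  then show False using edge_props(1)[OF tree] by blast
qed

text \<open>\<open>m'\<close> is the net effect of copying entry \<open>l\<close> behind the list
  and of three writes into the copy. All changes happen from \<open>F\<close> on, past the table and
  the earlier entries.\<close>

lemma holds_list_append:
  assumes m: "holds_list m L" and l: "l < length L" "L ! l = X" and j: "1 \<le> j" "j < k"
    and X: "finite X" "edge j \<notin> X"
    and F: "F = off (length L)" and p: "p = par j"
    and m': "m' = (\<lambda>a. if F \<le> a \<and> a < F + 2 * k then m (a - F + off l) else m a)
      (F + j := 1, F + k + p := Suc (incidence X (node p)),
       F + k + j := Suc (incidence X (node j)))"
  shows "holds_list m' (L @ [insert (edge j) X])"
  unfolding holds_list_def
proof (intro conjI allI impI)
  fix a assume a: "a < 3 * k"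
  have "3 * k \<le> F" by (simp add: F off_ge)
  with a m show "m' a = m0 a" by (simp add: m' holds_list_def)
next
  have pk: "p < k" "p \<noteq> j" using par_less[OF j] par_neq[OF j] p by auto
  fix q assume "q < length (L @ [insert (edge j) X])"
  then consider "q < length L" | "q = length L" by fastforce
  then show "holds_set m' (off q) ((L @ [insert (edge j) X]) ! q)"
  proof cases
    case 1
    have "off q + 2 * k \<le> F" using off_less[OF 1] F by simp
    then have "m' (off q + i) = m (off q + i)" if "i < 2 * k" for i
      using that by (simp add: m')
    from this this[of "k + _"] have "m' (off q + i) = m (off q + i)"
      "m' (off q + k + i) = m (off q + k + i)" if "i < k" for i
      using that by (simp_all add: add.assoc)
    moreover have "holds_set m (off q) (L ! q)" using m 1 by (simp add: holds_list_def)
    ultimately show ?thesis using 1 by (simp add: holds_set_def nth_append)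
  next
    case 2
    have mX: "holds_set m (off l) X" using m l by (auto simp: holds_list_def)
    have "holds_set m' F (insert (edge j) X)"
      unfolding holds_set_def
    proof (intro conjI allI impI)
      fix i assume i: "1 \<le> i \<and> i < k"
      have "edge i = edge j \<longleftrightarrow> i = j"
        using i j k_eq es_props(1) by (auto simp: edge_def nth_eq_iff_index_eq split: if_splits)
      moreover have "i \<noteq> j \<Longrightarrow> m' (F + i) = m (off l + i)"
        using i by (simp add: m' add.commute)
      moreover have "m' (F + j) = 1" using j by (simp add: m')
      ultimately show "m' (F + i) = (if edge i \<in> insert (edge j) X then 1 else 0)"
        using mX i by (auto simp: holds_set_def)
    next
      fix i assume i: "i < k"
      have "m' (F + k + i) = m (off l + k + i)" if "i \<noteq> j" "i \<noteq> p"
        using i that j by (simp add: m' add_ac)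
      moreover have "m' (F + k + j) = Suc (incidence X (node j))" by (simp add: m')
      moreover have "m' (F + k + p) = Suc (incidence X (node p))" using pk by (simp add: m')
      ultimately show "m' (F + k + i) = incidence (insert (edge j) X) (node i)"
        using mX i node_mem_edge_iff[OF j i] p
        by (auto simp: holds_set_def incidence_insert[OF X])
    qed
    with 2 F show ?thesis by (simp add: nth_append)
  qed
qed

text \<open>The loop counts through the list \<open>L\<close> present at the start of the round,
  while the memory holds the growing list \<open>L'\<close>.\<close>

definition entry_inv :: "nat \<Rightarrow> (reg \<Rightarrow> nat) \<Rightarrow> (nat \<Rightarrow> nat) \<Rightarrow> bool" where
  "entry_inv j r m \<longleftrightarrow>
     (let L = sublist_upto j;
          L' = L @ filter (legal V E) (map (insert (edge j)) (take (r rI) L))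
      in r rK = k \<and> r rBase = 3 * k \<and> r rWidth = 2 * k \<and> r rJ = j \<and>
         r rA = par j \<and> r rDA = degree E (node (par j)) \<and> r rDJ = degree E (node j) \<and>
         r rCount = length L \<and> r rI \<le> length L \<and> r rQ = off (r rI) \<and>
         r rLen = length L' \<and> r rFree = off (length L') \<and> holds_list m L')"

text \<open>Copying \<open>2 * k\<close> cells at four steps each gives \<open>8 * k\<close>; the
  constants 20 are generous for the other commands. The second summand is counted against
  \<open>N\<close>, not against the end of the round, and so need not be refilled between
  rounds.\<close>

definition entry_potential :: "(reg \<Rightarrow> nat) \<Rightarrow> nat" where
  "entry_potential r = 20 * (r rCount - r rI) + (8 * k + 20) * (N - r rLen)"

text \<open>The facts on the list needed for one iteration, separated from the symbolic execution.
  The last one guarantees that a new entry still has its payment and its space.\<close>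

lemma entry_step:
  assumes inv: "entry_inv j r m" and j: "1 \<le> j" "j < k" and i: "r rI < r rCount"
  defines "L \<equiv> sublist_upto j"
  defines "L' \<equiv> L @ filter (legal V E) (map (insert (edge j)) (take (r rI) L))"
    and "X \<equiv> L ! r rI"
  shows "r rI < length L'" "L' ! r rI = X" "finite X" "edge j \<notin> X"
    "m (off (r rI) + k + par j) = incidence X (node (par j))"
    "m (off (r rI) + k + j) = incidence X (node j)"
    "legal V E (insert (edge j) X) \<longleftrightarrow>
       2 * (incidence X (node (par j)) + 1) \<le> degree E (node (par j)) \<and>
       2 * (incidence X (node j) + 1) \<le> degree E (node j)"
    "L @ filter (legal V E) (map (insert (edge j)) (take (Suc (r rI)) L)) =
       L' @ (if legal V E (insert (edge j) X) then [insert (edge j) X] else [])"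
    "length L' + (if legal V E (insert (edge j) X) then 1 else 0) \<le> N"
proof -
  have iL: "r rI < length L" using i inv by (simp add: entry_inv_def Let_def L_def)
  then show iL': "r rI < length L'" and nth: "L' ! r rI = X"
    by (simp_all add: L'_def X_def nth_append)
  have "X \<in> set (sublist_upto j)" using iL by (simp add: X_def L_def)
  note X = sublist_upto_props[OF j this]
  then show "finite X" "edge j \<notin> X" by auto
  have hl: "holds_list m L'"
    using inv by (simp add: entry_inv_def Let_def L'_def L_def)
  then have hs: "holds_set m (off (r rI)) X"
    using iL' nth by (auto simp: holds_list_def)
  show "m (off (r rI) + k + par j) = incidence X (node (par j))"
    "m (off (r rI) + k + j) = incidence X (node j)"
    using hs par_less[OF j] j by (auto simp: holds_set_def)
  have e: "edge j = {node (par j), node j}" using edge_eq[OF j] by auto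
  show "legal V E (insert (edge j) X) \<longleftrightarrow>
       2 * (incidence X (node (par j)) + 1) \<le> degree E (node (par j)) \<and>
       2 * (incidence X (node j) + 1) \<le> degree E (node j)"
    using legal_insert_iff[OF tree X(1), of "node (par j)" "node j"] edge_in_E2[OF j] X(3)
    by (simp add: e)
  show eq: "L @ filter (legal V E) (map (insert (edge j)) (take (Suc (r rI)) L)) =
       L' @ (if legal V E (insert (edge j) X) then [insert (edge j) X] else [])"
    using iL by (simp add: take_Suc_conv_app_nth L'_def X_def)
  \<comment> \<open>Completing the visited prefix to all of \<open>L\<close> yields the list of the
    next round, whose length is at most \<open>N\<close>.\<close>
  have "length L' + (if legal V E (insert (edge j) X) then 1 else 0) =
      length (L @ filter (legal V E) (map (insert (edge j)) (take (Suc (r rI)) L)))"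
    unfolding eq by simp
  also have "\<dots> \<le> length (L @ filter (legal V E) (map (insert (edge j))
      (take (Suc (r rI)) L @ drop (Suc (r rI)) L)))"
    unfolding map_append filter_append by simp
  also have "\<dots> = length (sublist_upto (Suc j))"
    using sublist_upto_Suc[OF j] by (simp add: L_def)
  also have "\<dots> \<le> N" by (rule length_sublist_upto_le)
  finally show "length L' + (if legal V E (insert (edge j) X) then 1 else 0) \<le> N" .
qed

lemma entry_body:
  assumes inv: "entry_inv j r m" and j: "1 \<le> j" "j < k" and i: "r rI < r rCount"
  shows "terminates inp
     (rX ::= MEM[Rg rQ \<oplus> Rg rK \<oplus> Rg rA];;
     rY ::= MEM[Rg rQ \<oplus> Rg rK \<oplus> Rg rJ];;
     rX ::= Rg rX \<oplus> Cn 1;;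
     rY ::= Rg rY \<oplus> Cn 1;;
     (IF Rg rX \<oplus> Rg rX \<lless> Rg rDA \<oplus> Cn 1 \<and>\<^sub>b Rg rY \<oplus> Rg rY \<lless> Rg rDJ \<oplus> Cn 1 THEN (
        rP ::= Cn 0;;
        copy_loop;;
        MEM[Rg rFree \<oplus> Rg rJ] ::= Cn 1;;
        MEM[Rg rFree \<oplus> Rg rK \<oplus> Rg rA] ::= Rg rX;;
        MEM[Rg rFree \<oplus> Rg rK \<oplus> Rg rJ] ::= Rg rY;;
        rFree ::= Rg rFree \<oplus> Rg rWidth;;
        rLen ::= Rg rLen \<oplus> Cn 1)
      ELSE Skip);;
     rQ ::= Rg rQ \<oplus> Rg rWidth;;
     rI ::= Rg rI \<oplus> Cn 1) (conf r m) (off N)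
   (\<lambda>t s'. entry_inv j (regs s') (mem s') \<and>
     Suc t + entry_potential (regs s') \<le> entry_potential r)"
proof -
  define L where "L = sublist_upto j"
  define L' where "L' = L @ filter (legal V E) (map (insert (edge j)) (take (r rI) L))"
  define X where "X = L ! r rI"
  define leg where "leg \<longleftrightarrow> legal V E (insert (edge j) X)"
  \<comment> \<open>Empty or a singleton: both branches of the test end in the same claim
    \<open>post\<close>.\<close>
  define new where "new = (if leg then [insert (edge j) X] else [])"
  note st = entry_step[OF inv j i, folded L_def, folded L'_def X_def, folded leg_def]
  have R: "r rK = k" "r rBase = 3 * k" "r rWidth = 2 * k" "r rJ = j"
    "r rA = par j" "r rDA = degree E (node (par j))" "r rDJ = degree E (node j)"
    "r rCount = length L" "r rQ = off (r rI)"
    "r rLen = length L'" "r rFree = off (length L')" and hl: "holds_list m L'"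
    using inv by (simp_all add: entry_inv_def Let_def L'_def L_def)
  have p: "par j < k" using par_less[OF j] .
  have offi: "off (r rI) + 2 * k \<le> off (length L')" using st(1) by (rule off_less)
  have offN: "off (length L') \<le> off N" using st(9) by (intro off_mono) auto
  \<comment> \<open>A further entry fits below the cap because it counts towards \<open>N\<close> as
    well.\<close>
  have room: "leg \<Longrightarrow> off (length L') + 2 * k \<le> off N"
    using st(9) by (intro off_less) auto
  have post: "entry_inv j r2 m2 \<and> t + entry_potential r2 \<le> entry_potential r"
    if "r2 rK = k" "r2 rBase = 3 * k" "r2 rWidth = 2 * k" "r2 rJ = j"
      "r2 rA = par j" "r2 rDA = degree E (node (par j))" "r2 rDJ = degree E (node j)"
      "r2 rCount = length L" "r2 rI = Suc (r rI)" "r2 rQ = off (Suc (r rI))"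
      "r2 rLen = length (L' @ new)" "r2 rFree = off (length (L' @ new))"
      "holds_list m2 (L' @ new)" "t \<le> 20 + (8 * k) * length new" for r2 m2 t
  proof
    have "r2 rI \<le> length L" using that i R(8) by simp
    moreover have "L @ filter (legal V E) (map (insert (edge j)) (take (r2 rI) L)) = L' @ new"
      using st(8) that(9) by (simp add: new_def)
    ultimately show "entry_inv j r2 m2"
      using that unfolding entry_inv_def Let_def L_def[symmetric] by simp
    \<comment> \<open>Writing the larger numbers as sums removes the truncated differences from the
      potential.\<close>
    obtain c where c: "length L = r rI + Suc c"
      using i R(8) less_imp_Suc_add by fastforce
    show "t + entry_potential r2 \<le> entry_potential r"
    proof (cases leg)
      case True
      then obtain d where "N = length L' + Suc d"
        using st(9) less_imp_Suc_add[of "length L'" N] by auto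
      with that R(8,10) c True show ?thesis by (simp add: entry_potential_def new_def)
    next
      case False
      with that R(8,10) c show ?thesis by (simp add: entry_potential_def new_def)
    qed
  qed
  show ?thesis
    apply ((rule terminates_basic | (simp add: R st(5,6); fail))+)
    subgoal premises c
    proof -
      \<comment> \<open>The strict comparison with the degree plus one is the bound without
        division.\<close>
      from c have leg using st(7) by (simp add: R mult_2 Suc_le_eq)
      then have new: "new = [insert (edge j) X]" by (simp add: new_def)
      show ?thesis
        apply ((rule terminates_copy_loop))
        subgoal by simp
        subgoal using offi by (simp add: R)
        subgoal using room[OF \<open>leg\<close>] by (simp add: R)
        subgoal premises q for t r' m'
        proof -
          have q2: "r' x = r x" if "x \<notin> {rX, rY, rP, rZ}" for x using q(2) that by simp
          have q2': "r' rX = Suc (incidence X (node (par j)))" "r' rY = Suc (incidence X (node j))"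
            using q(2) by simp_all
          have "m' = (\<lambda>a. if off (length L') \<le> a \<and> a < off (length L') + 2 * k
              then m (a - off (length L') + off (r rI)) else m a)"
            using q(3) by (simp add: R cong: if_cong)
          then have H: "holds_list (m'(off (length L') + j := 1,
              off (length L') + k + par j := Suc (incidence X (node (par j))),
              off (length L') + k + j := Suc (incidence X (node j)))) (L' @ [insert (edge j) X])"
            by (intro holds_list_append[OF hl st(1,2) j st(3,4)]) simp_all
          show ?thesis
            apply ((rule terminates_basic | (simp add: q2 q2' R; fail))+)
            subgoal
              apply (simp only: state.simps, rule post)
              using H q(1) apply (simp_all add: q2 R new off_Suc)
              done
            using room[OF \<open>leg\<close>] p j by (simp_all)
        qed
        done
    qed
    subgoal premises c
    proof -
      from c have "\<not> leg" using st(7) by (simp add: R mult_2 Suc_le_eq)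
      then have new: "new = []" by (simp add: new_def)
      show ?thesis
        apply ((rule terminates_basic | (simp add: R; fail))+)
        apply (simp only: state.simps, rule post)
        using hl apply (simp_all add: R new off_Suc)
        done
    qed
    using offi offN j p by simp_all
qed

lemma terminates_entry_loop:
  assumes inv: "entry_inv j r m" and j: "1 \<le> j" "j < k"
    and post: "\<And>t r' m'. entry_inv j r' m' \<Longrightarrow> r' rI = r' rCount \<Longrightarrow>
      t + entry_potential r' \<le> Suc (entry_potential r) \<Longrightarrow> Q t (conf r' m')"
  shows "terminates inp entry_loop (conf r m) (off N) Q"
  unfolding entry_loop_def
proof (rule terminates_While[where I = "entry_inv j" and p = "\<lambda>r _. entry_potential r"], goal_cases)
  case 1
  show ?case by (rule inv)
next
  case (2 r m)
  then show ?case by (intro entry_body j) auto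
next
  case (3 t r' m')
  then show ?case by (intro post) (auto simp: entry_inv_def Let_def)
qed

definition edge_inv :: "(reg \<Rightarrow> nat) \<Rightarrow> (nat \<Rightarrow> nat) \<Rightarrow> bool" where
  "edge_inv r m \<longleftrightarrow> r rK = k \<and> r rBase = 3 * k \<and> r rWidth = 2 * k \<and> 1 \<le> r rJ \<and>
     r rLen = length (sublist_upto (r rJ)) \<and> r rFree = off (r rLen) \<and>
     holds_list m (sublist_upto (r rJ))"

text \<open>Every remaining row pays for visiting at most \<open>N\<close> entries; the payment for
  missing entries is the one of \<open>entry_potential\<close>.\<close>

definition edge_potential :: "(reg \<Rightarrow> nat) \<Rightarrow> nat" where
  "edge_potential r = (20 * N + 30) * (k - r rJ) + (8 * k + 20) * (N - r rLen)"

lemma edge_body: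
  assumes inv: "edge_inv r m" and j: "r rJ < k"
  shows "terminates inp
    (rA ::= MEM[Rg rJ \<oplus> Rg rJ \<oplus> Rg rJ \<oplus> Cn 1];;
     rDA ::= MEM[Rg rA \<oplus> Rg rA \<oplus> Rg rA \<oplus> Cn 2];;
     rDJ ::= MEM[Rg rJ \<oplus> Rg rJ \<oplus> Rg rJ \<oplus> Cn 2];;
     rCount ::= Rg rLen;;
     rQ ::= Rg rBase;;
     rI ::= Cn 0;;
     entry_loop;;
     rJ ::= Rg rJ \<oplus> Cn 1) (conf r m) (off N)
    (\<lambda>t s'. edge_inv (regs s') (mem s') \<and> Suc t + edge_potential (regs s') \<le> edge_potential r)"
proof -
  define j where "j = r rJ"
  have j: "1 \<le> j" "j < k" using inv \<open>r rJ < k\<close> by (simp_all add: edge_inv_def j_def)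
  define L where "L = sublist_upto j"
  have R: "r rK = k" "r rBase = 3 * k" "r rWidth = 2 * k" "r rJ = j" "r rLen = length L"
    "r rFree = off (length L)" and hl: "holds_list m L"
    using inv by (simp_all add: edge_inv_def j_def L_def)
  have m: "m a = m0 a" if "a < 3 * k" for a using hl that by (simp add: holds_list_def)
  have p: "par j < k" using par_less[OF j] .
  have "m (3 * j + 1) = par j" "m (3 * par j + 2) = degree E (node (par j))"
    "m (3 * j + 2) = degree E (node j)"
    using j p by (simp_all add: m par_def row_degree[unfolded add_2_eq_Suc'])
  moreover have "3 * i = i + i + i" for i :: nat by simp
  ultimately have M: "m (Suc (j + j + j)) = par j"
    "m (Suc (Suc (par j + par j + par j))) = degree E (node (par j))"
    "m (Suc (Suc (j + j + j))) = degree E (node j)"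
    by (simp_all only: add_2_eq_Suc' Suc_eq_plus1[symmetric])
  have off: "3 * k \<le> off N" by (rule off_ge)
  have LN: "length L \<le> N" unfolding L_def by (rule length_sublist_upto_le)
  show ?thesis
    apply ((rule terminates_basic | (simp add: R M; fail))+)
    subgoal
      apply (rule terminates_entry_loop[OF _ j])
      subgoal using hl by (simp add: entry_inv_def Let_def R L_def off_0)
      subgoal premises q for t r' m'
      proof -
        have "r' rI = length (sublist_upto j)"
          using q(1,2) by (simp add: entry_inv_def Let_def)
        \<comment> \<open>With the visited prefix being the whole list, the inner invariant
          describes the list of the next round.\<close>
        then have all: "take (r' rI) (sublist_upto j) = sublist_upto j" by simp
        have R': "r' rK = k" "r' rBase = 3 * k" "r' rWidth = 2 * k" "r' rJ = j"
          "r' rLen = length (sublist_upto (Suc j))" "r' rFree = off (length (sublist_upto (Suc j)))"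
          "holds_list m' (sublist_upto (Suc j))"
          using q(1) unfolding entry_inv_def Let_def all sublist_upto_Suc[OF j] by simp_all
        have t: "t + (8 * k + 20) * (N - length (sublist_upto (Suc j)))
          \<le> Suc (20 * length L + (8 * k + 20) * (N - length L))"
          using q(2,3) by (simp add: entry_potential_def R R'(5))
        have inv': "edge_inv (r'(rJ := Suc j)) m'" using R' by (simp add: edge_inv_def)
        \<comment> \<open>Naming the products makes the remaining estimate linear.\<close>
        define A where "A = (20 * N + 30) * (k - Suc j)"
        define B where "B = (8 * k + 20) * (N - length L)"
        define B' where "B' = (8 * k + 20) * (N - length (sublist_upto (Suc j)))"
        have "k - j = Suc (k - Suc j)" using j(2) by simp
        then have "edge_potential r = A + 20 * N + 30 + B"
          unfolding edge_potential_def R A_def B_def by simp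
        moreover have "edge_potential (r'(rJ := Suc j)) = A + B'"
          unfolding edge_potential_def A_def B'_def using R' by simp
        moreover have "t + B' \<le> Suc (20 * N + B)"
          using t LN unfolding B_def[symmetric] B'_def[symmetric] by linarith
        ultimately have pot: "10 + t + edge_potential (r'(rJ := Suc j)) \<le> edge_potential r"
          by linarith
        show ?thesis
          apply ((rule terminates_basic | (simp add: R'; fail))+)
          using inv' pot by simp
      qed
      done
    using j p off by simp_all
qed

text \<open>Clearing \<open>2 * k\<close> cells at three steps each writes the entry of the empty
  set, so \<open>N - 1\<close> entries remain to be paid for.\<close>

lemma terminates_enumerate_legal:
  assumes r: "r rK = k"
  shows "terminates inp enumerate_legal (conf r m0) (off N) (\<lambda>t s'. regs s' rK = k \<and>
    regs s' rLen = N \<and> holds_list (mem s') (legal_list V E es) \<and>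
    t \<le> 20 + 6 * k + (20 * N + 30) * k + (8 * k + 20) * (N - 1))"
proof -
  have "1 \<le> N" using length_sublist_upto_le[of 0] by (simp add: legal_list_def)
  then have off: "off 1 \<le> off N" by (rule off_mono)
  have off1: "off 1 = 3 * k + 2 * k" by (simp add: off_def)
  have *: "edge_inv r' m'" if "r' rK = k" "r' rBase = 3 * k" "r' rWidth = 2 * k" "r' rJ = 1"
    "r' rLen = 1" "r' rFree = off 1" "m' = (\<lambda>a. if k + k + k \<le> a \<and> a < k + k + k + (k + k) then 0 else m0 a)" for r' m'
    using that by (simp add: edge_inv_def legal_list_def holds_list_def off_0 holds_set_def incidence_def)
  show ?thesis
    unfolding enumerate_legal_eq
    apply ((rule terminates_basic | (simp add: r; fail))+)
    subgoal
      apply (rule terminates_clear_loop)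
      subgoal by simp
      subgoal using off unfolding off1 by simp
      subgoal premises q for t r' m'
      proof -
        have q': "r' x = r x" if "x \<notin> {rBase, rWidth, rFree, rP}" for x using q(2) that by simp
        have q'': "r' rBase = 3 * k" "r' rWidth = 2 * k" "r' rFree = off 1"
          using q(2) by (simp_all add: r off_def)
        show ?thesis
          apply ((rule terminates_basic | (simp add: q' q'' r; fail))+)
          subgoal unfolding edge_loop_def
            apply (rule terminates_While[where I = edge_inv and p = "\<lambda>r _. edge_potential r"])
            subgoal using q(3) by (intro *) (simp_all add: q' q'' r cong: if_cong)
            subgoal by (rule edge_body) (simp_all add: edge_inv_def)
            subgoal premises e for t' r2 m2
            proof -
              have "k \<le> r2 rJ" "r2 rK = k" "r2 rLen = length (sublist_upto (r2 rJ))"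
                "holds_list m2 (sublist_upto (r2 rJ))"
                using e(1,2) by (simp_all add: edge_inv_def)
              \<comment> \<open>\<open>k - 1\<close> is the number of edges for a nonempty table
                and, by truncation, also for an empty one.\<close>
              moreover from this have "sublist_upto (r2 rJ) = legal_list V E es"
                using k_eq by (cases es) auto
              moreover have "t \<le> Suc (6 * k)" using q(1) by (simp add: r)
              moreover have "t' \<le> Suc ((20 * N + 30) * k + (8 * k + 20) * (N - 1))"
              proof -
                have "t' \<le> Suc ((20 * N + 30) * (k - 1) + (8 * k + 20) * (N - 1))"
                  using e(3) by (simp add: edge_potential_def)
                moreover have "(20 * N + 30) * (k - 1) \<le> (20 * N + 30) * k"
                  by (intro mult_le_mono) auto
                ultimately show ?thesis by linarith
              qed
              ultimately show ?thesis by simp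
            qed
            done
          done
      qed
      done
    done
qed

text \<open>The table survives and has a row for every edge of \<open>E2 E\<close>, so decoding
  yields each entry cut down to \<open>E2 E\<close>; legal sets lose nothing by that.\<close>

lemma decoded_output_eq:
  assumes m0: "m0 = mem s" and node: "node = tab_node vs s"
    and s': "regs s' rK = k" "regs s' rLen = N" "holds_list (mem s') (legal_list V E es)"
  shows "decoded_output vs s' = legal_list V E es"
proof (rule nth_equalityI)
  show "length (decoded_output vs s') = length (legal_list V E es)"
    by (simp add: decoded_output_def Let_def s')
  fix l assume "l < length (decoded_output vs s')"
  then have l: "l < N" by (simp add: decoded_output_def Let_def s')
  have "mem s' a = m0 a" if "a < 3 * k" for a
    using s'(3) that by (simp add: holds_list_def)
  then have "tab_edge vs s' j = edge j" if "j \<in> {1..<k}" for j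
    using that row_ref[of j] edge_eq[of j] by (simp add: tab_edge_def tab_node_def node par_def m0[symmetric])
  moreover have "mem s' (3 * k + l * (2 * k) + j) = 1 \<longleftrightarrow> edge j \<in> legal_list V E es ! l"
    if "j \<in> {1..<k}" for j
    using s'(3) l that by (simp add: holds_list_def holds_set_def off_def)
  ultimately have "decoded_output vs s' ! l =
      {edge j | j. j \<in> {1..<k} \<and> edge j \<in> legal_list V E es ! l}"
    using l by (auto simp: decoded_output_def Let_def s')
  also have "\<dots> = edge ` {1..<k} \<inter> legal_list V E es ! l" by blast
  also have "edge ` {1..<k} = E2 E"
  proof -
    have "{1..<k} = Suc ` {..<length es}"
      using k_eq by (auto simp: image_Suc_lessThan)
    then have "edge ` {1..<k} = set es"
      by (auto simp: image_image edge_def set_conv_nth)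
    then show ?thesis using es_props by simp
  qed
  also have "legal_list V E es ! l \<in> E_fix V E"
    using set_legal_list(2)[OF tree order] nth_mem[OF l] by simp
  then have "legal_list V E es ! l \<subseteq> E2 E" by (simp add: E_fix_def legal_def)
  then have "E2 E \<inter> legal_list V E es ! l = legal_list V E es ! l" by blast
  finally show "decoded_output vs s' ! l = legal_list V E es ! l" .
qed

end

lemma enumerate_legal_correct:
  assumes tree: "tree V E" and order: "is_order es (E2 E)" and tab: "edge_table vs E es s"
  shows "\<exists>t m s'. run inp enumerate_legal s t m s' \<and> decoded_output vs s' = legal_list V E es \<and>
    t \<le> 200 * (1 + card (fixed_points M V E) * card (E2 E)) \<and>
    m \<le> 200 * (card (E2 E) * card (fixed_points M V E))"
proof -
  let ?k = "regs s rK" and ?F = "card (fixed_points M V E)" and ?e = "card (E2 E)"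
    and ?N = "length (legal_list V E es)"
  interpret edge_list V E es "?k" "tab_node vs s" "mem s"
    using tree order tab
    by unfold_locales (auto simp: edge_table_def Let_def tab_edge_def)
  have s: "conf (regs s) (mem s) = s" by simp
  obtain t m s' where run: "run inp enumerate_legal s t m s'" and m: "m \<le> off ?N"
    and s': "regs s' rK = ?k" "regs s' rLen = ?N" "holds_list (mem s') (legal_list V E es)"
    and t: "t \<le> 20 + 6 * ?k + (20 * ?N + 30) * ?k + (8 * ?k + 20) * (?N - 1)"
    using terminates_enumerate_legal[of "regs s" inp] unfolding s terminates_def by blast
  have "?N \<ge> 1" using length_sublist_upto_le[of 0] by (simp add: legal_list_def)
  have NF: "?N \<le> ?F" by (rule length_legal_list_le[OF tree order])
  have e: "?e = length es" using es_props distinct_card by metis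
  have "t \<le> 200 * (1 + ?F * ?e) \<and> m \<le> 200 * (?e * ?F)"
  proof (cases "es = []")
    case True
    then have "?k = 0" "?N = 1" using k_eq by (simp_all add: legal_list_def)
    with t m[unfolded off_def] show ?thesis by simp
  next
    case False
    \<comment> \<open>From here on \<open>k = |E2| + 1\<close> may be replaced by
      \<open>2 * |E2|\<close>.\<close>
    then have k: "?k \<le> 2 * ?e" "1 \<le> ?e" using k_eq e by (cases es; simp)+
    have "?N * ?k \<le> ?F * (2 * ?e)" using NF k by (intro mult_le_mono)
    define P where "P = ?F * ?e"
    then have P: "?F * ?e = P" "?e * ?F = P" by simp_all
    define q where "q = ?N * ?k"
    have "q \<le> 2 * P" using \<open>?N * ?k \<le> ?F * (2 * ?e)\<close> by (simp add: q_def P_def)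
    moreover have "?e \<le> P" "?F \<le> P" using \<open>?N \<ge> 1\<close> NF k by (simp_all add: P_def)
    moreover have "t \<le> 20 + 36 * ?k + 28 * q + 20 * ?N"
    proof -
      have "(8 * ?k + 20) * (?N - 1) \<le> (8 * ?k + 20) * ?N" by (intro mult_le_mono) auto
      with t have "t \<le> 20 + 6 * ?k + (20 * ?N + 30) * ?k + (8 * ?k + 20) * ?N" by linarith
      also have "\<dots> = 20 + 36 * ?k + 28 * q + 20 * ?N"
        by (simp add: q_def algebra_simps)
      finally show ?thesis .
    qed
    moreover have "m \<le> 3 * ?k + 2 * q"
    proof -
      have "off ?N = 3 * ?k + 2 * q" by (simp add: off_def q_def)
      with m show ?thesis by simp
    qed
    ultimately show ?thesis unfolding P using k NF by auto
  qed
  with run decoded_output_eq[OF refl refl s'] show ?thesis by blast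
qed

section \<open>Traversing the tree of edges between inner nodes\<close>

text \<open>The counterpart of \<open>tab_edge\<close> over abstract rows, which keeps the graph
  argument free of memory addresses.\<close>

definition table_edge :: "(nat \<Rightarrow> 'a) \<Rightarrow> (nat \<Rightarrow> nat) \<Rightarrow> nat \<Rightarrow> 'a set" where
  "table_edge node par r = {node r, node (par r)}"

text \<open>The state of the traversal with \<open>K\<close> rows filled: rows below \<open>i\<close> are processed, and of the
  neighbours of the node in row \<open>i\<close> those in \<open>D\<close>.\<close>

definition traversal ::
    "'a set set \<Rightarrow> nat \<Rightarrow> (nat \<Rightarrow> 'a) \<Rightarrow> (nat \<Rightarrow> nat) \<Rightarrow> nat \<Rightarrow> 'a set \<Rightarrow> bool" where
  "traversal E K node par i D \<longleftrightarrow>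
     0 < K \<and> i \<le> K \<and> inj_on node {..<K} \<and> (\<forall>r<K. 2 \<le> degree E (node r)) \<and> par 0 = 0 \<and>
     (\<forall>r. 1 \<le> r \<and> r < K \<longrightarrow> par r < r \<and> table_edge node par r \<in> E \<and>
        (par r < i \<or> par r = i \<and> node r \<in> D)) \<and>
     (\<forall>r<i. \<forall>w. {node r, w} \<in> E2 E \<longrightarrow> {node r, w} \<in> table_edge node par ` {1..<K}) \<and>
     (\<forall>w\<in>D. {node i, w} \<in> E2 E \<longrightarrow> {node i, w} \<in> table_edge node par ` {1..<K})"

lemma traversalD:
  assumes "traversal E K node par i D"
  shows "0 < K" "i \<le> K" "inj_on node {..<K}" "\<And>r. r < K \<Longrightarrow> 2 \<le> degree E (node r)" "par 0 = 0"
    "\<And>r. 1 \<le> r \<Longrightarrow> r < K \<Longrightarrow> par r < r"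
    "\<And>r. 1 \<le> r \<Longrightarrow> r < K \<Longrightarrow> table_edge node par r \<in> E"
    "\<And>r. 1 \<le> r \<Longrightarrow> r < K \<Longrightarrow> par r < i \<or> par r = i \<and> node r \<in> D"
    "\<And>r w. r < i \<Longrightarrow> {node r, w} \<in> E2 E \<Longrightarrow> {node r, w} \<in> table_edge node par ` {1..<K}"
    "\<And>w. w \<in> D \<Longrightarrow> {node i, w} \<in> E2 E \<Longrightarrow> {node i, w} \<in> table_edge node par ` {1..<K}"
  using assms unfolding traversal_def by simp_all

context
  fixes V :: "'a set" and E :: "'a set set"
  assumes tree: "tree V E"
begin

lemma traversal_edges_subset:
  assumes "traversal E K node par i D"
  shows "table_edge node par ` {1..<K} \<subseteq> E2 E"
proof
  note T = traversalD[OF assms]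
  fix e assume "e \<in> table_edge node par ` {1..<K}"
  then obtain r where r: "1 \<le> r" "r < K" "e = table_edge node par r" by auto
  have "par r < K" using T(6)[OF r(1,2)] r(2) by simp
  then show "e \<in> E2 E"
    using T(4)[of r] T(4)[of "par r"] T(7)[OF r(1,2)] r(2,3)
    by (auto simp: table_edge_def E2_pair_iff[OF tree])
qed

text \<open>Two rows with the same edge and swapped ends would be parents of each other, against
  \<open>par r < r\<close>.\<close>

lemma traversal_inj_edges:
  assumes "traversal E K node par i D"
  shows "inj_on (table_edge node par) {1..<K}"
proof (rule inj_onI)
  note T = traversalD[OF assms]
  fix r s assume rs: "r \<in> {1..<K}" "s \<in> {1..<K}" "table_edge node par r = table_edge node par s"
  have p: "par r < r" "par s < s" using T(6) rs(1,2) by simp_all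
  from rs(3) have "node r = node s \<or> node r = node (par s) \<and> node s = node (par r)"
    by (auto simp: table_edge_def doubleton_eq_iff)
  then have "r = s \<or> r = par s \<and> s = par r"
    using inj_onD[OF T(3)] rs(1,2) p by (auto simp: less_trans)
  with p show "r = s" by auto
qed

lemma traversal_size:
  assumes "traversal E K node par i D"
  shows "K \<le> Suc (card (E2 E))"
proof -
  have "K - 1 = card (table_edge node par ` {1..<K})"
    using card_image[OF traversal_inj_edges[OF assms]] by simp
  also have "\<dots> \<le> card (E2 E)"
    by (intro card_mono finite_E2[OF tree] traversal_edges_subset[OF assms])
  finally show ?thesis by simp
qed

lemma traversal_connected:
  assumes "traversal E K node par i D" "r < K"
  shows "(node 0, node r) \<in> (adj (table_edge node par ` {1..<K}))\<^sup>*"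
  using assms(2)
proof (induction r rule: less_induct)
  case (less r)
  show ?case
  proof (cases "r = 0")
    case False
    then have "par r < r" using traversalD(6)[OF assms(1)] less.prems by simp
    moreover from this have "(node 0, node (par r)) \<in> (adj (table_edge node par ` {1..<K}))\<^sup>*"
      using less by simp
    moreover have "{node (par r), node r} \<in> table_edge node par ` {1..<K}"
      using False less.prems by (auto simp: table_edge_def image_iff)
    ultimately show ?thesis by (auto intro: rtrancl_into_rtrancl)
  qed simp
qed

text \<open>A neighbour other than the parent is new: otherwise the edge to it would close a cycle with
  the edges of the table.\<close>

lemma traversal_new_node:
  assumes trav: "traversal E K node par i D" and i: "i < K"
    and w: "{node i, w} \<in> E" "w \<noteq> node (par i)" "w \<notin> D"
  shows "w \<notin> node ` {..<K}"
proof
  note T = traversalD[OF trav]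
  let ?F = "table_edge node par ` {1..<K}"
  assume "w \<in> node ` {..<K}"
  then obtain r where r: "r < K" "w = node r" by auto
  have neq: "node i \<noteq> w" using w(1) edge_props(1)[OF tree] by blast
  \<comment> \<open>A row with this edge would make \<open>w\<close> the parent of row
    \<open>i\<close> or a child already treated in \<open>D\<close>.\<close>
  have "{node i, w} \<notin> ?F"
  proof
    assume "{node i, w} \<in> ?F"
    then obtain s where s: "1 \<le> s" "s < K" "{node i, node r} = {node s, node (par s)}"
      using r by (auto simp: table_edge_def)
    have ps: "par s < K" using T(6)[OF s(1,2)] s(2) by simp
    from s(3) consider "node i = node s" "node r = node (par s)"
      | "node i = node (par s)" "node r = node s" by (auto simp: doubleton_eq_iff)
    then show False
    proof cases
      case 1
      then have "i = s" using inj_onD[OF T(3)] i s(2) by simp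
      with 1 r w(2) show False by simp
    next
      case 2
      then have "i = par s" "r = s" using inj_onD[OF T(3)] i r s(2) ps by simp_all
      with T(8)[OF s(1,2)] w(3) r(2) show False by auto
    qed
  qed
  then have sub: "?F \<subseteq> E - {{node i, w}}"
    using traversal_edges_subset[OF trav] E2_subset[of E] by auto
  \<comment> \<open>The table joins the two nodes through row 0 without this edge.\<close>
  have "(node i, w) \<in> (adj ?F)\<^sup>*"
    using rtrancl_trans[OF rtrancl_adj_sym[OF traversal_connected[OF trav i]]
        traversal_connected[OF trav r(1)]] r(2) by simp
  moreover have "adj ?F \<subseteq> adj (E - {{node i, w}})" using sub by blast
  ultimately have "(node i, w) \<in> (adj (E - {{node i, w}}))\<^sup>*" using rtrancl_mono by blast
  with acyclic_edge_is_bridge[OF w(1) neq tree_acyclic[OF tree]] show False by contradiction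
qed

lemma traversal_append:
  assumes trav: "traversal E K node par i D" and i: "i < K"
    and w: "{node i, w} \<in> E" "w \<noteq> node (par i)" "w \<notin> D" "2 \<le> degree E w"
  shows "traversal E (Suc K) (node(K := w)) (par(K := i)) i (insert w D)"
proof -
  note T = traversalD[OF trav]
  have new: "w \<notin> node ` {..<K}" by (rule traversal_new_node[OF trav i w(1-3)])
  have old: "table_edge (node(K := w)) (par(K := i)) r = table_edge node par r" if "1 \<le> r" "r < K" for r
    using T(6)[OF that] that by (simp add: table_edge_def)
  have last: "table_edge (node(K := w)) (par(K := i)) K = {node i, w}"
    using i by (auto simp: table_edge_def)
  have "{1..<Suc K} = insert K {1..<K}" using T(1) by auto
  then have img: "table_edge (node(K := w)) (par(K := i)) ` {1..<Suc K} =
      insert {node i, w} (table_edge node par ` {1..<K})"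
    using old last by simp
  have inj: "inj_on (node(K := w)) {..<Suc K}"
    using T(3) new unfolding lessThan_Suc by (auto simp: inj_on_def)
  show ?thesis
    unfolding traversal_def img
  proof (intro conjI allI impI ballI)
    fix r assume r: "1 \<le> r \<and> r < Suc K"
    show "(par(K := i)) r < r" using r T(6)[of r] i by auto
    show "table_edge (node(K := w)) (par(K := i)) r \<in> E"
      using r T(7)[of r] old[of r] last w(1) by (cases "r = K") auto
    show "(par(K := i)) r < i \<or> (par(K := i)) r = i \<and> (node(K := w)) r \<in> insert w D"
      using r T(8)[of r] by auto
  next
    fix r u assume "r < i" "{(node(K := w)) r, u} \<in> E2 E"
    then show "{(node(K := w)) r, u} \<in> insert {node i, w} (table_edge node par ` {1..<K})"
      using T(9)[of r u] i by simp
  next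
    fix u assume "u \<in> insert w D" "{(node(K := w)) i, u} \<in> E2 E"
    then show "{(node(K := w)) i, u} \<in> insert {node i, w} (table_edge node par ` {1..<K})"
      using T(10)[of u] i by auto
  next
    fix r assume "r < Suc K"
    then show "2 \<le> degree E ((node(K := w)) r)" using T(4)[of r] w(4) by auto
  qed (use inj T i in simp_all)
qed

text \<open>A leaf contributes no edge of \<open>E2 E\<close>, and the edge to the parent is row
  \<open>i\<close> itself.\<close>

lemma traversal_skip:
  assumes trav: "traversal E K node par i D" and i: "i < K"
    and w: "{node i, w} \<in> E" "w = node (par i) \<or> degree E w < 2"
  shows "traversal E K node par i (insert w D)"
proof -
  note T = traversalD[OF trav]
  have "{node i, w} \<in> table_edge node par ` {1..<K}" if "{node i, w} \<in> E2 E"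
  proof -
    have "degree E w \<ge> 2" using that by (simp add: E2_pair_iff[OF tree])
    with w(2) have w_eq: "w = node (par i)" by simp
    \<comment> \<open>The root refers to itself, so the parent test never rejects one of its
      neighbours.\<close>
    have "i \<noteq> 0" using edge_props(1)[OF tree w(1)] T(5) w_eq by metis
    with i w_eq show ?thesis by (auto simp: table_edge_def image_iff)
  qed
  with trav show ?thesis unfolding traversal_def by auto
qed

lemma traversal_next:
  assumes trav: "traversal E K node par i D" and i: "i < K" and D: "nbrs E (node i) \<subseteq> D"
  shows "traversal E K node par (Suc i) {}"
proof -
  note T = traversalD[OF trav]
  have "{node r, w} \<in> table_edge node par ` {1..<K}" if "r < Suc i" "{node r, w} \<in> E2 E" for r w
  proof (cases "r = i")
    case True
    have "w \<in> D" using that(2) True D E2_subset[of E] by (auto simp: nbrs_def)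
    then show ?thesis using T(10) that(2) True by simp
  next
    case False
    then show ?thesis using T(9) that by simp
  qed
  moreover have "par r < Suc i" if "1 \<le> r" "r < K" for r using T(8)[OF that] by auto
  ultimately show ?thesis using T i unfolding traversal_def by simp
qed

text \<open>The rows are closed under adjacency in the connected graph \<open>E2 E\<close> and so
  exhaust its nodes; each edge was recorded when the row of an end was processed.\<close>

lemma traversal_complete:
  assumes trav: "traversal E K node par K {}"
  shows "table_edge node par ` {1..<K} = E2 E"
proof
  note T = traversalD[OF trav]
  show "table_edge node par ` {1..<K} \<subseteq> E2 E" by (rule traversal_edges_subset[OF trav])
  have in_table: "z \<in> node ` {..<K}" if "{y, z} \<in> table_edge node par ` {1..<K}" for y z
  proof -
    from that obtain r where r: "1 \<le> r" "r < K" "{y, z} = {node r, node (par r)}"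
      by (auto simp: table_edge_def)
    moreover have "par r < K" using T(6)[OF r(1,2)] r(2) by simp
    ultimately show ?thesis by (auto simp: doubleton_eq_iff)
  qed
  show "E2 E \<subseteq> table_edge node par ` {1..<K}"
  proof
    fix e assume e: "e \<in> E2 E"
    then have "e \<in> E" using E2_subset by blast
    then show "e \<in> table_edge node par ` {1..<K}"
    proof (rule edgeE[OF tree])
      fix x y assume xy: "e = {x, y}" "x \<in> V"
      have root: "2 \<le> degree E (node 0)" using T(1,4) by simp
      then have "nbrs E (node 0) \<noteq> {}" by (auto simp: degree_eq_card_nbrs[OF tree])
      then have "node 0 \<in> V" using edge_props(2)[OF tree] by (auto simp: nbrs_def)
      then have "(node 0, x) \<in> (adj (E2 E))\<^sup>*"
        using E2_connected[OF tree _ xy(2) root] e xy(1) by (simp add: E2_pair_iff[OF tree])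
      then have "x \<in> node ` {..<K}"
      proof (induction rule: rtrancl_induct)
        case base
        show ?case using T(1) by blast
      next
        case (step y z)
        then obtain r where "r < K" "y = node r" by auto
        with step(2) T(9)[of r z] in_table show ?case by blast
      qed
      then obtain r where "r < K" "x = node r" by auto
      with T(9)[of r y] e xy(1) show ?thesis by simp
    qed
  qed
qed

end

section \<open>Computing the edges between inner nodes\<close>

definition scan_row_loop :: com where
  "scan_row_loop = (WHILE Rg rA \<lless> Rg rB DO (
     rW ::= INP[Rg rA];;
     rC ::= INP[Cn 1 \<oplus> Rg rW];;
     rD ::= INP[Cn 2 \<oplus> Rg rW];;
     (IF Cn 1 \<lless> Rg rD \<ominus> Rg rC THEN (rRoot ::= Rg rV;; rK ::= Cn 1) ELSE Skip);;
     rA ::= Rg rA \<oplus> Cn 1))"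

definition scan_loop :: com where
  "scan_loop = (WHILE Rg rV \<lless> Rg rN DO (
     rA ::= INP[Cn 1 \<oplus> Rg rV];;
     rB ::= INP[Cn 2 \<oplus> Rg rV];;
     (IF Cn 1 \<lless> Rg rB \<ominus> Rg rA THEN scan_row_loop ELSE Skip);;
     rV ::= Rg rV \<oplus> Cn 1))"

definition visit_loop :: com where
  "visit_loop = (WHILE Rg rA \<lless> Rg rB DO (
     rW ::= INP[Rg rA];;
     rC ::= INP[Cn 1 \<oplus> Rg rW];;
     rD ::= INP[Cn 2 \<oplus> Rg rW];;
     (IF Rg rW \<noteq>\<^sub>b Rg rU \<and>\<^sub>b Cn 1 \<lless> Rg rD \<ominus> Rg rC THEN (
        MEM[Rg rK \<oplus> Rg rK \<oplus> Rg rK] ::= Rg rW;;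
        MEM[Rg rK \<oplus> Rg rK \<oplus> Rg rK \<oplus> Cn 1] ::= Rg rI;;
        MEM[Rg rK \<oplus> Rg rK \<oplus> Rg rK \<oplus> Cn 2] ::= Rg rD \<ominus> Rg rC;;
        rK ::= Rg rK \<oplus> Cn 1)
      ELSE Skip);;
     rA ::= Rg rA \<oplus> Cn 1))"

definition queue_loop :: com where
  "queue_loop = (WHILE Rg rI \<lless> Rg rK DO (
     rV ::= MEM[Rg rI \<oplus> Rg rI \<oplus> Rg rI];;
     rU ::= MEM[Rg rI \<oplus> Rg rI \<oplus> Rg rI \<oplus> Cn 1];;
     rU ::= MEM[Rg rU \<oplus> Rg rU \<oplus> Rg rU];;
     rA ::= INP[Cn 1 \<oplus> Rg rV];;
     rB ::= INP[Cn 2 \<oplus> Rg rV];;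
     visit_loop;;
     rI ::= Rg rI \<oplus> Cn 1))"

lemma compute_E2_eq:
  "compute_E2 =
    (rN ::= INP[Cn 0];;
     rK ::= Cn 0;;
     rV ::= Cn 0;;
     scan_loop;;
     (IF Cn 0 \<lless> Rg rK THEN (
        rA ::= INP[Cn 1 \<oplus> Rg rRoot];;
        rB ::= INP[Cn 2 \<oplus> Rg rRoot];;
        MEM[Cn 0] ::= Rg rRoot;;
        MEM[Cn 1] ::= Cn 0;;
        MEM[Cn 2] ::= Rg rB \<ominus> Rg rA)
      ELSE Skip);;
     rI ::= Cn 0;;
     queue_loop)"
  by (simp add: compute_E2_def scan_row_loop_def scan_loop_def visit_loop_def queue_loop_def)

text \<open>Columns of the table differ in their residue modulo three, so a write to one does not
  disturb another.\<close>

lemma mod3_neq: "3 * q \<noteq> Suc (3 * l)" "Suc (3 * l) \<noteq> 3 * q"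
    "3 * q \<noteq> Suc (Suc (3 * l))" "Suc (Suc (3 * l)) \<noteq> 3 * q"
  by presburger+

lemma triple: "x + x + x = 3 * (x :: nat)"
  by simp

locale tree_input =
  fixes V :: "'a set" and E :: "'a set set" and inp :: "nat \<Rightarrow> nat" and vs :: "'a list"
  assumes tree: "tree V E" and input: "represents inp vs V E"
begin

abbreviation n :: nat where "n \<equiv> length vs"

abbreviation lo :: "nat \<Rightarrow> nat" where "lo i \<equiv> inp (Suc i)"

abbreviation hi :: "nat \<Rightarrow> nat" where "hi i \<equiv> inp (Suc (Suc i))"

abbreviation d :: "nat \<Rightarrow> nat" where "d i \<equiv> hi i - lo i"

abbreviation nbr :: "nat \<Rightarrow> 'a" where "nbr x \<equiv> vs ! inp x"

lemma vs: "distinct vs" "set vs = V"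
  using input by (auto simp: represents_def is_order_def)

lemma inp_0: "inp 0 = n"
  using input by (simp add: represents_def)

lemma inp_less: "i < n \<Longrightarrow> lo i \<le> x \<Longrightarrow> x < hi i \<Longrightarrow> inp x < n"
  using input by (simp add: represents_def)

lemma bij_nbr: "i < n \<Longrightarrow> bij_betw nbr {lo i..<hi i} (nbrs E (vs ! i))"
  using input by (simp add: represents_def)

lemma degree_eq: "i < n \<Longrightarrow> degree E (vs ! i) = d i"
  using bij_betw_same_card[OF bij_nbr] by (simp add: degree_eq_card_nbrs[OF tree])

lemma nbr_edge: "i < n \<Longrightarrow> lo i \<le> x \<Longrightarrow> x < hi i \<Longrightarrow> {vs ! i, nbr x} \<in> E"
  using bij_betwE[OF bij_nbr] by (auto simp: nbrs_def)

lemma sum_d: "(\<Sum>i<n. d i) \<le> 2 * card V" and card_V: "card V = n"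
proof -
  show "card V = n" using vs distinct_card by metis
  have "(\<Sum>i<n. d i) = (\<Sum>i<n. degree E (vs ! i))" by (simp add: degree_eq)
  also have "\<dots> = (\<Sum>v\<in>V. degree E v)"
    using sum.reindex_bij_betw[OF bij_betw_nth[OF vs(1) refl vs(2)[symmetric]], of "degree E"] by simp
  finally show "(\<Sum>i<n. d i) \<le> 2 * card V" using sum_degree_le[OF tree] by simp
qed

section \<open>Searching the input for a root\<close>

definition inner_edge_at :: "nat \<Rightarrow> bool" where
  "inner_edge_at i \<longleftrightarrow> 1 < d i \<and> (\<exists>x\<in>{lo i..<hi i}. 1 < d (inp x))"

lemma E2_empty_iff: "E2 E = {} \<longleftrightarrow> (\<forall>i<n. \<not> inner_edge_at i)"
proof
  assume *: "\<forall>i<n. \<not> inner_edge_at i"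
  show "E2 E = {}"
  proof (rule ccontr)
    assume "E2 E \<noteq> {}"
    then obtain e where e: "e \<in> E2 E" by blast
    then have "e \<in> E" using E2_subset by blast
    then show False
    proof (rule edgeE[OF tree])
      fix u v assume uv: "e = {u, v}" "u \<in> V" "v \<in> V"
      then have "u \<in> set vs" using vs(2) by simp
      then obtain i where i: "i < n" "u = vs ! i" unfolding in_set_conv_nth by blast
      have "v \<in> nbrs E (vs ! i)" using \<open>e \<in> E\<close> uv i by (simp add: nbrs_def)
      then have "v \<in> nbr ` {lo i..<hi i}"
        using bij_betw_imp_surj_on[OF bij_nbr[OF i(1)]] by simp
      then obtain x where "x \<in> {lo i..<hi i}" and v: "v = nbr x" by (rule imageE)
      then have x: "lo i \<le> x" "x < hi i" by simp_all
      have "2 \<le> degree E (vs ! i)" "2 \<le> degree E (nbr x)"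
        using e uv(1) i(2) v by (simp_all add: E2_pair_iff[OF tree])
      then have "2 \<le> d i" "2 \<le> d (inp x)"
        using degree_eq[OF i(1)] degree_eq[OF inp_less[OF i(1) x(1,2)]] by simp_all
      then have "inner_edge_at i"
        unfolding inner_edge_at_def using x by (intro conjI bexI[of _ x]) simp_all
      with * i(1) show False by blast
    qed
  qed
next
  assume *: "E2 E = {}"
  show "\<forall>i<n. \<not> inner_edge_at i"
  proof (intro allI impI notI)
    fix i assume i: "i < n" "inner_edge_at i"
    then obtain x where x: "lo i \<le> x" "x < hi i" "1 < d i" "1 < d (inp x)"
      by (auto simp: inner_edge_at_def)
    then have "{vs ! i, nbr x} \<in> E2 E"
      using nbr_edge[OF i(1) x(1,2)] degree_eq[OF i(1)] degree_eq[OF inp_less[OF i(1) x(1,2)]]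
      by (simp add: E2_pair_iff[OF tree])
    with * show False by simp
  qed
qed

text \<open>\<open>P\<close> stands for a success so far. A further success merely replaces the
  root.\<close>

definition root_found :: "(reg \<Rightarrow> nat) \<Rightarrow> bool \<Rightarrow> bool" where
  "root_found r P \<longleftrightarrow>
     r rK = 0 \<and> \<not> P \<or> r rK = 1 \<and> r rRoot < n \<and> inner_edge_at (r rRoot)"

lemma terminates_scan_row_loop:
  assumes i: "i < n" "1 < d i" and r: "r rV = i" "r rA = lo i" "r rB = hi i"
    and found: "root_found r (\<exists>i'<i. inner_edge_at i')"
    and post: "\<And>t r'. t \<le> Suc (10 * d i) \<Longrightarrow>
      \<forall>x. x \<notin> {rW, rC, rD, rA, rRoot, rK} \<longrightarrow> r' x = r x \<Longrightarrow>
      root_found r' (\<exists>i'<Suc i. inner_edge_at i') \<Longrightarrow> Q t (conf r' m)"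
  shows "terminates inp scan_row_loop (conf r m) M Q"
  unfolding scan_row_loop_def
proof (rule terminates_While[where p = "\<lambda>r' _. 10 * (hi i - r' rA)" and
      I = "\<lambda>r' m'. m' = m \<and> (\<forall>x. x \<notin> {rW, rC, rD, rA, rRoot, rK} \<longrightarrow> r' x = r x) \<and>
        lo i \<le> r' rA \<and> r' rA \<le> hi i \<and>
        root_found r' ((\<exists>i'<i. inner_edge_at i') \<or> (\<exists>x\<in>{lo i..<r' rA}. 1 < d (inp x)))"], goal_cases)
  case 1
  show ?case using i r found by simp
next
  case (2 r' m')
  then have r': "r' rV = i" "r' rB = hi i" "lo i \<le> r' rA" "r' rA < hi i" "m' = m"
    "\<forall>x. x \<notin> {rW, rC, rD, rA, rRoot, rK} \<longrightarrow> r' x = r x"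
    and f: "root_found r' ((\<exists>i'<i. inner_edge_at i') \<or> (\<exists>x\<in>{lo i..<r' rA}. 1 < d (inp x)))"
    using r by simp_all
  show ?case
    apply ((rule terminates_basic | (simp; fail))+)
    subgoal premises c
    proof -
      have edge: "inner_edge_at i"
        unfolding inner_edge_at_def using c i(2) r'(3,4) by (intro conjI bexI[of _ "r' rA"]) simp_all
      show ?thesis using edge r' i by (simp add: root_found_def)
    qed
    subgoal premises c
    proof -
      have ivl: "{lo i..<Suc (r' rA)} = insert (r' rA) {lo i..<r' rA}" using r'(3) by auto
      show ?thesis
        apply ((rule terminates_basic | (simp; fail))+)
        using ivl c r' f by (simp add: root_found_def)
    qed
    done
next
  case (3 t r' m')
  then have m': "m' = m" and "r' rA = hi i" using r by simp_all
  moreover have "(\<exists>i'<Suc i. inner_edge_at i') \<longleftrightarrow>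
      (\<exists>i'<i. inner_edge_at i') \<or> (\<exists>x\<in>{lo i..<hi i}. 1 < d (inp x))"
    using i(2) by (auto simp: inner_edge_at_def less_Suc_eq)
  ultimately show ?case
    using 3 r by (intro post[of _ r', folded m']) simp_all
qed

lemma terminates_scan_loop:
  assumes r: "r rV = 0" "r rN = n" "r rK = 0"
    and post: "\<And>t r'. t \<le> Suc (\<Sum>i<n. 10 * d i + 10) \<Longrightarrow>
      root_found r' (\<exists>i<n. inner_edge_at i) \<Longrightarrow> Q t (conf r' m)"
  shows "terminates inp scan_loop (conf r m) M Q"
  unfolding scan_loop_def
\<comment> \<open>The cost of a node grows with its degree, hence a sum over the nodes not yet
  scanned.\<close>
proof (rule terminates_While[where p = "\<lambda>r' _. \<Sum>i=r' rV..<n. 10 * d i + 10" and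
      I = "\<lambda>r' m'. m' = m \<and> r' rN = n \<and> r' rV \<le> n \<and> root_found r' (\<exists>i<r' rV. inner_edge_at i)"],
    goal_cases)
  case 1
  show ?case using r by (simp add: root_found_def)
next
  case (2 r' m')
  define i where "i = r' rV"
  have r': "r' rV = i" "i < n" "r' rN = n" "m' = m" "root_found r' (\<exists>i'<i. inner_edge_at i')"
    using 2 by (simp_all add: i_def)
  have sum: "(\<Sum>i=i..<n. 10 * d i + 10) = 10 * d i + 10 + (\<Sum>i=Suc i..<n. 10 * d i + 10)"
    using r'(2) by (rule sum.atLeast_Suc_lessThan)
  show ?case
    apply ((rule terminates_basic | (simp add: r'; fail))+)
    subgoal premises c
      apply (rule terminates_scan_row_loop[OF r'(2)])
      using c r' apply (simp_all add: root_found_def)[5]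
      subgoal premises q for t r2
      proof -
        have "r2 rV = i" "r2 rN = n" using q(2) r' by simp_all
        note this [simp]
        show ?thesis
          apply ((rule terminates_basic | (simp; fail))+)
          using q(1,3) r' sum by (simp add: root_found_def)
      qed
      done
    subgoal premises c
    proof -
      have no_edge: "\<not> inner_edge_at i" using c r' by (simp add: inner_edge_at_def)
      show ?thesis
        apply ((rule terminates_basic | (simp add: r'; fail))+)
        using no_edge r' sum by (auto simp: root_found_def less_Suc_eq)
    qed
    done
next
  case (3 t r' m')
  then have m': "m' = m" and "r' rV = n" by simp_all
  with 3 show ?case using r by (intro post[of _ r', folded m']) (auto simp: lessThan_atLeast0)
qed

section \<open>The traversal in memory\<close>

definition table_inv :: "nat \<Rightarrow> (nat \<Rightarrow> nat) \<Rightarrow> nat \<Rightarrow> 'a set \<Rightarrow> bool" where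
  "table_inv K m i D \<longleftrightarrow>
     traversal E K (\<lambda>q. vs ! m (3 * q)) (\<lambda>q. m (Suc (3 * q))) i D \<and>
     (\<forall>q<K. m (3 * q) < n \<and> m (Suc (Suc (3 * q))) = d (m (3 * q)))"

lemma terminates_visit_loop:
  assumes inv: "table_inv (r rK) m i {}" and i: "i < r rK" and M: "3 * Suc (card (E2 E)) \<le> M"
    and r: "r rI = i" "r rV = v" "r rU = m (3 * m (Suc (3 * i)))" "r rA = lo v" "r rB = hi v"
    and v: "v = m (3 * i)"
    and post: "\<And>t r' m'. t \<le> Suc (15 * d v) \<Longrightarrow>
      \<forall>x. x \<notin> {rW, rC, rD, rA, rK} \<longrightarrow> r' x = r x \<Longrightarrow> \<forall>a<3 * Suc i. m' a = m a \<Longrightarrow>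
      i < r' rK \<Longrightarrow> table_inv (r' rK) m' (Suc i) {} \<Longrightarrow> Q t (conf r' m')"
  shows "terminates inp visit_loop (conf r m) M Q"
proof -
  note T = traversalD[OF conjunct1[OF inv[unfolded table_inv_def]]]
  have vn: "v < n" using inv i by (simp add: table_inv_def v)
  have par_le: "m (Suc (3 * i)) \<le> i" using T(5) T(6)[of i] i by (cases "i = 0") auto
  have U: "r rU < n" using inv par_le i by (simp add: table_inv_def r)
  have "2 \<le> d v" using T(4)[OF i] degree_eq[OF vn] by (simp add: v)
  \<comment> \<open>The address range is not reversed, so \<open>rA \<le> hi v\<close> holds
    initially.\<close>
  then have lohi: "lo v < hi v" by simp
  \<comment> \<open>Appended rows lie behind row \<open>i\<close>, so the cells fixed here keep
    \<open>rU\<close> equal to the parent's node throughout.\<close>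
  define I where "I r' m' \<longleftrightarrow> (\<forall>x. x \<notin> {rW, rC, rD, rA, rK} \<longrightarrow> r' x = r x) \<and>
    lo v \<le> r' rA \<and> r' rA \<le> hi v \<and> i < r' rK \<and> (\<forall>a<3 * Suc i. m' a = m a) \<and>
    table_inv (r' rK) m' i (nbr ` {lo v..<r' rA})" for r' m'
  have fin: "Q t (conf r' m')"
    if inv': "I r' m'" and A: "r' rA = hi v" and t: "t \<le> Suc (15 * d v)" for t r' m'
  proof -
    have "vs ! m' (3 * i) = vs ! v" using inv' by (simp add: I_def v)
    then have "nbrs E (vs ! m' (3 * i)) \<subseteq> nbr ` {lo v..<hi v}"
      using bij_betw_imp_surj_on[OF bij_nbr[OF vn]] by simp
    then have "table_inv (r' rK) m' (Suc i) {}"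
      using inv' traversal_next[OF tree, of "r' rK"] A unfolding I_def table_inv_def by metis
    with inv' t show ?thesis unfolding I_def by (intro post) simp_all
  qed
  show ?thesis
    unfolding visit_loop_def
  proof (rule terminates_While[where I = I and p = "\<lambda>r' _. 15 * (hi v - r' rA)"], goal_cases)
    case 1
    show ?case using i r inv lohi by (simp add: I_def)
  next
    case (2 r' m')
    define K where "K = r' rK"
    define A where "A = r' rA"
    define w where "w = inp A"
    define node where "node q = vs ! m' (3 * q)" for q
    define par where "par q = m' (Suc (3 * q))" for q
    have I: "I r' m'" by fact
    have r': "r' rI = i" "r' rV = v" "r' rU = m (3 * m (Suc (3 * i)))" "r' rB = hi v" "r' rK = K"
      "r' rA = A" "i < K" "lo v \<le> A" "A < hi v" "\<And>x. x \<notin> {rW, rC, rD, rA, rK} \<Longrightarrow> r' x = r x"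
      "\<And>a. a < 3 * Suc i \<Longrightarrow> m' a = m a"
      using 2 r by (simp_all add: I_def K_def A_def)
    have trav: "traversal E K node par i (nbr ` {lo v..<A})"
      and tab: "\<And>q. q < K \<Longrightarrow> m' (3 * q) < n \<and> m' (Suc (Suc (3 * q))) = d (m' (3 * q))"
      using I unfolding I_def table_inv_def K_def A_def node_def par_def by simp_all
    have wn: "w < n" using inp_less[OF vn r'(8,9)] by (simp add: w_def)
    have node_i: "node i = vs ! v" using r'(11)[of "3 * i"] by (simp add: node_def v)
    have par_i: "node (par i) = vs ! (r' rU)"
      using r'(11)[of "Suc (3 * i)"] r'(11)[of "3 * m (Suc (3 * i))"] par_le
      by (simp add: node_def par_def r'(3))
    have edge: "{node i, vs ! w} \<in> E" using nbr_edge[OF vn r'(8,9)] by (simp add: node_i w_def)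
    \<comment> \<open>No neighbour is listed twice in the input.\<close>
    have new: "vs ! w \<notin> nbr ` {lo v..<A}"
    proof
      assume "vs ! w \<in> nbr ` {lo v..<A}"
      then obtain x where x: "x \<in> {lo v..<A}" "nbr A = nbr x" unfolding w_def by blast
      have "A = x"
        using x(1) r'(8,9) by (intro inj_onD[OF bij_betw_imp_inj_on[OF bij_nbr[OF vn]] x(2)]) simp_all
      with x(1) show False by simp
    qed
    \<comment> \<open>The program compares positions, the traversal compares nodes;
      \<open>vs\<close> has no repetitions.\<close>
    have neq: "vs ! w = node (par i) \<longleftrightarrow> w = r' rU"
      using vs(1) wn U r by (simp add: par_i r'(3) nth_eq_iff_index_eq)
    have ivl: "nbr ` {lo v..<Suc A} = insert (vs ! w) (nbr ` {lo v..<A})"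
    proof -
      have "{lo v..<Suc A} = insert A {lo v..<A}" using r'(8) by auto
      then show ?thesis by (simp add: w_def)
    qed
    have app: "traversal E (Suc K) (node(K := vs ! w)) (par(K := i)) i (nbr ` {lo v..<Suc A})"
      if "w \<noteq> r' rU" "1 < d w"
      unfolding ivl using that degree_eq[OF wn] neq
      by (intro traversal_append[OF tree trav r'(7) edge] new) simp_all
    \<comment> \<open>The prospective table still consists of distinct edges of \<open>E2 E\<close>,
      so the new row fits.\<close>
    have KM: "3 * K + 3 \<le> M" if "w \<noteq> r' rU" "1 < d w"
      using traversal_size[OF tree app[OF that]] M by simp
    have skip: "traversal E K node par i (nbr ` {lo v..<Suc A})" if "w = r' rU \<or> \<not> 1 < d w"
      unfolding ivl using that degree_eq[OF wn] neq
      by (intro traversal_skip[OF tree trav r'(7) edge]) auto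
    show ?case
      apply ((rule terminates_basic | (simp add: r' triple w_def[symmetric]; fail))+)
      subgoal premises c
      proof -
        have c: "w \<noteq> r' rU" "1 < d w" using c by (simp_all add: w_def)
        let ?m = "m'(3 * K := w, Suc (3 * K) := i, Suc (Suc (3 * K)) := d w)"
        have "(\<lambda>q. vs ! ?m (3 * q)) = node(K := vs ! w)" "(\<lambda>q. ?m (Suc (3 * q))) = par(K := i)"
          by (auto simp: fun_eq_iff node_def par_def mod3_neq)
        then have "table_inv (Suc K) ?m i (nbr ` {lo v..<Suc A})"
          using app[OF c] tab wn unfolding table_inv_def by (auto simp: less_Suc_eq mod3_neq)
        moreover have "\<forall>a<3 * Suc i. ?m a = m a" using r'(7,11) by auto
        ultimately show ?thesis using r' by (simp add: I_def)
      qed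
      subgoal using KM by (simp add: w_def)
      subgoal using KM by (simp add: w_def)
      subgoal using KM by (simp add: w_def)
      subgoal premises c
      proof -
        have "table_inv K m' i (nbr ` {lo v..<Suc A})"
          using skip c tab unfolding table_inv_def node_def par_def by (auto simp: w_def)
        then have *: "I (r'(rW := w, rC := lo w, rD := hi w, rA := Suc A)) m'"
          using r' by (simp add: I_def)
        show ?thesis
          apply ((rule terminates_basic | (simp add: r'; fail))+)
          using * r' by (simp add: w_def)
      qed
      done
  next
    case (3 t r' m')
    then have "r' rA = hi v" using r by (simp add: I_def)
    with 3 r show ?case by (intro fin) simp_all
  qed
qed

text \<open>The number of rows is not known in advance, so the potential sums over the nodes outside
  of the processed rows. Rows have distinct nodes, hence each node is paid for at most once.\<close>

lemma terminates_queue_loop: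
  assumes inv: "table_inv (r rK) m 0 {}" and r: "r rI = 0" and M: "3 * Suc (card (E2 E)) \<le> M"
    and post: "\<And>t r' m'. t \<le> Suc (\<Sum>x<n. 15 * d x + 15) \<Longrightarrow>
      table_inv (r' rK) m' (r' rK) {} \<Longrightarrow> Q t (conf r' m')"
  shows "terminates inp queue_loop (conf r m) M Q"
  unfolding queue_loop_def
proof (rule terminates_While[where
      p = "\<lambda>r' m'. \<Sum>x\<in>{..<n} - (\<lambda>q. m' (3 * q)) ` {..<r' rI}. 15 * d x + 15" and
      I = "\<lambda>r' m'. table_inv (r' rK) m' (r' rI) {}"], goal_cases)
  case 1
  show ?case using inv r by simp
next
  case (2 r m)
  define i where "i = r rI"
  define v where "v = m (3 * i)"
  define S where "S = {..<n} - (\<lambda>q. m (3 * q)) ` {..<i}"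
  have inv: "table_inv (r rK) m i {}" and i: "i < r rK" "r rI = i" using 2 by (simp_all add: i_def)
  note trav = conjunct1[OF inv[unfolded table_inv_def]]
  note T = traversalD[OF trav]
  have tab: "m (3 * q) < n" if "q < r rK" for q using inv that by (simp add: table_inv_def)
  have "m (3 * i) \<noteq> m (3 * q)" if "q < i" for q
    using inj_onD[OF T(3), of i q] i that by auto
  then have v: "v \<in> S" using tab[OF i(1)] by (auto simp: S_def v_def)
  have sum: "(\<Sum>x\<in>S. 15 * d x + 15) = 15 * d v + 15 + (\<Sum>x\<in>S - {v}. 15 * d x + 15)"
    using v by (intro sum.remove) (simp_all add: S_def)
  have KM: "3 * r rK \<le> M" using traversal_size[OF tree trav] M by simp
  have "m (Suc (3 * i)) \<le> i" using T(5) T(6)[of i] i by (cases "i = 0") auto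
  then have par: "m (Suc (3 * i)) < r rK" using i by simp
  show ?case
    apply ((rule terminates_basic | (simp add: i triple v_def[symmetric]; fail))+)
    subgoal
      apply (rule terminates_visit_loop[where i = i and v = v])
      subgoal using inv i by simp
      subgoal using i by simp
      subgoal by (rule M)
      subgoal using i by simp
      subgoal by simp
      subgoal by simp
      subgoal by simp
      subgoal by simp
      subgoal by (rule v_def)
      subgoal premises q for t r' m'
      proof -
        have "r' rI = i" using q(2) i by simp
        have "m' (3 * q) = m (3 * q)" if "q < Suc i" for q using q(3) that by simp
        then have "(\<lambda>q. m' (3 * q)) ` {..<Suc i} = (\<lambda>q. m (3 * q)) ` {..<Suc i}"
          by (intro image_cong) auto
        then have S': "{..<n} - (\<lambda>q. m' (3 * q)) ` {..<Suc i} = S - {v}"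
          by (auto simp: S_def v_def lessThan_Suc)
        show ?thesis
          apply ((rule terminates_basic | (simp add: \<open>r' rI = i\<close>; fail))+)
          using q(1,5) S' sum by (simp add: i S_def[symmetric])
      qed
      done
    using KM i par by simp_all
next
  case (3 t r' m')
  have "r' rI = r' rK" using 3 traversalD(2)[OF conjunct1[OF 3(1)[unfolded table_inv_def]]] by simp
  with 3 r show ?case by (intro post) simp_all
qed

lemma edge_table_of_table_inv:
  assumes inv: "table_inv K m K {}" and ne: "E2 E \<noteq> {}" and s: "regs s rK = K" "mem s = m"
  shows "is_order (map (tab_edge vs s) [1..<K]) (E2 E)"
    and "edge_table vs E (map (tab_edge vs s) [1..<K]) s"
proof -
  note trav = conjunct1[OF inv[unfolded table_inv_def]]
  note T = traversalD[OF trav]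
  have tab: "m (3 * q) < n" "m (Suc (Suc (3 * q))) = degree E (vs ! m (3 * q))" if "q < K" for q
    using inv that degree_eq by (simp_all add: table_inv_def)
  have te: "tab_edge vs s = table_edge (\<lambda>q. vs ! m (3 * q)) (\<lambda>q. m (Suc (3 * q)))"
    by (simp add: fun_eq_iff tab_edge_def table_edge_def tab_node_def s)
  show "is_order (map (tab_edge vs s) [1..<K]) (E2 E)"
    unfolding is_order_def te
    using traversal_complete[OF tree trav] traversal_inj_edges[OF tree trav]
    by (simp add: distinct_map)
  \<comment> \<open>A lone root row would be at odds with \<open>edge_table\<close>, which asks for
    \<open>k = 0\<close> if there are no edges.\<close>
  have K: "K \<noteq> 1" using traversal_complete[OF tree trav] ne by auto
  have par: "m (Suc (3 * j)) < K" if "j \<in> {1..<K}" for j using T(6)[of j] that by simp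
  show "edge_table vs E (map (tab_edge vs s) [1..<K]) s"
    using T(1,3) tab K par unfolding edge_table_def Let_def s
    by (auto simp: tab_node_def[abs_def] s)
qed

lemma table_inv_root:
  assumes root: "v < n" "inner_edge_at v" and m: "m 0 = v" "m (Suc 0) = 0" "m (Suc (Suc 0)) = d v"
  shows "table_inv 1 m 0 {}"
  using assms degree_eq[OF root(1)]
  by (simp add: table_inv_def traversal_def inner_edge_at_def lessThan_Suc)

lemma compute_E2_correct:
  "\<exists>t m s'. run inp compute_E2 s t m s' \<and>
     (\<exists>es. is_order es (E2 E) \<and> edge_table vs E es s') \<and>
     t \<le> 20 + 80 * card V \<and> m \<le> 6 * card (E2 E)"
proof -
  \<comment> \<open>Three cells for each of at most \<open>|E2| + 1\<close> rows; for empty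
    \<open>E2\<close> the cap is zero and nothing is written.\<close>
  define M where "M = 6 * card (E2 E)"
  define Q where "Q t s' \<longleftrightarrow> (\<exists>es. is_order es (E2 E) \<and> edge_table vs E es s') \<and> t \<le> 20 + 80 * n" for t s'
  \<comment> \<open>Degrees contribute \<open>2 * n\<close> and the nodes themselves
    \<open>n\<close>. With \<open>c\<close> being 10 and 15 the loops cost about
    \<open>75 * n\<close>.\<close>
  have sum: "(\<Sum>i<n. c * d i + c) \<le> 3 * (c * n)" for c
  proof -
    have "(\<Sum>i<n. c * d i + c) = c * (\<Sum>i<n. d i) + c * n"
      by (simp add: sum.distrib sum_distrib_left)
    also have "c * (\<Sum>i<n. d i) \<le> c * (2 * n)" using sum_d card_V by (intro mult_le_mono) auto
    finally show ?thesis by simp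
  qed
  have none: "Q t (conf r' m')" if "r' rK = 0" "E2 E = {}" "t \<le> 20 + 80 * n" for t r' m'
    using that unfolding Q_def by (auto simp: is_order_def edge_table_def)
  have E2M: "3 * Suc (card (E2 E)) \<le> M" if "E2 E \<noteq> {}"
  proof -
    have "card (E2 E) \<noteq> 0" using that finite_E2[OF tree] by simp
    then show ?thesis by (simp add: M_def)
  qed
  obtain r m where s: "s = conf r m" by (cases s) auto
  have "terminates inp compute_E2 s M Q"
    unfolding compute_E2_eq s
    apply ((rule terminates_basic | (simp add: inp_0; fail))+)
    apply (rule terminates_scan_loop)
    subgoal by simp
    subgoal by (simp add: inp_0)
    subgoal by simp
    subgoal premises q for t r'
    proof -
      have t: "t \<le> Suc (30 * n)" using q(1) sum[of 10] by simp
      have big: "3 \<le> M" if "0 < r' rK"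
      proof -
        have "E2 E \<noteq> {}" using q(2) that E2_empty_iff by (auto simp: root_found_def)
        then show ?thesis using E2M by fastforce
      qed
      show ?thesis
        apply ((rule terminates_basic | (simp; fail))+)
        subgoal premises c
        proof -
          have root: "r' rK = 1" "r' rRoot < n" "inner_edge_at (r' rRoot)"
            using q(2) c by (simp_all add: root_found_def)
          then have ne: "E2 E \<noteq> {}" using E2_empty_iff by blast
          show ?thesis
            apply (rule terminates_queue_loop)
            subgoal using table_inv_root[OF root(2,3)] root(1) by simp
            subgoal by simp
            subgoal by (rule E2M[OF ne])
            subgoal premises f for t' r2 m2
            proof -
              have "t' \<le> Suc (45 * n)" using f(1) sum[of 15] by simp
              then show ?thesis
                using edge_table_of_table_inv[OF f(2) ne, of "conf r2 m2"] t
                by (auto simp: Q_def)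
            qed
            done
        qed
        subgoal using big by simp
        subgoal using big by simp
        subgoal using big by simp
        subgoal premises c
        proof -
          have K: "r' rK = 0" and empty: "E2 E = {}"
            using q(2) c E2_empty_iff by (auto simp: root_found_def)
          show ?thesis
            apply ((rule terminates_basic | (simp; fail))+)
            unfolding queue_loop_def
            apply (rule terminates_While[where I = "\<lambda>r _. r rK = 0" and p = "\<lambda>_ _. 0"])
            subgoal by (simp add: K)
            subgoal by simp
            subgoal for t' using t by (intro none empty) auto
            done
        qed
        done
    qed
    done
  then show ?thesis unfolding terminates_def Q_def M_def card_V by blast
qed

end

theorem theorem9:
  shows "\<exists>c::nat. \<forall>(V::'a set) E M. tree V E \<longrightarrow>
    (\<forall>es. is_order es (E2 E) \<longrightarrow>
       distinct (legal_list V E es) \<and>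
       set (legal_list V E es) = E_fix V E \<and>
       (\<forall>v\<in>V. bij_betw (conflict_edges M E)
          {f \<in> fixed_points M V E. f v = 0} (set (legal_list V E es)))) \<and>
    (\<forall>inp vs. represents inp vs V E \<longrightarrow>
       (\<forall>s. \<exists>es t m s'. is_order es (E2 E) \<and>
          run inp (compute_E2;; enumerate_legal) s t m s' \<and>
          decoded_output vs s' = legal_list V E es \<and>
          within_bounds c M V E t m) \<and>
       (\<forall>es s. is_order es (E2 E) \<and> edge_table vs E es s \<longrightarrow>
          (\<exists>t m s'. run inp enumerate_legal s t m s' \<and>
             decoded_output vs s' = legal_list V E es \<and>
             within_bounds c M V E t m)))"
proof (intro exI[of _ 300] allI impI)
  fix V :: "'a set" and E M
  assume tree: "tree V E"
  define F where "F = card (fixed_points M V E)"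
  define e where "e = card (E2 E)"
  have bounds: "within_bounds 300 M V E t m \<longleftrightarrow> t \<le> 300 * (card V + F * e) \<and> m \<le> 300 * (e * F)" for t m
    by (simp add: within_bounds_def F_def e_def)
  \<comment> \<open>Absorbs the additive constants: 20 of the traversal and 200 of the enumeration,
    together with the factor 80, give 300.\<close>
  have V: "1 \<le> card V" using tree_finite(1)[OF tree] tree_nonempty[OF tree] by (simp add: Suc_le_eq card_gt_0_iff)
  obtain v where "v \<in> V" using tree_nonempty[OF tree] by blast
  \<comment> \<open>Absorbs the memory of the table, which is linear in \<open>e\<close>
    alone.\<close>
  have F: "1 \<le> F"
  proof -
    have "{} \<in> E_fix V E" by (simp add: E_fix_def legal_def incidence_def)
    then show ?thesis
      using bij_betw_conflict_edges[OF tree \<open>v \<in> V\<close>, of M] finite_fixed_points[OF tree, of M]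
      by (auto simp: F_def Suc_le_eq card_gt_0_iff dest: bij_betw_imp_surj_on)
  qed
  note enum = enumerate_legal_correct[OF tree, where M = M, folded F_def e_def]
  show "(\<forall>es. is_order es (E2 E) \<longrightarrow>
       distinct (legal_list V E es) \<and>
       set (legal_list V E es) = E_fix V E \<and>
       (\<forall>v\<in>V. bij_betw (conflict_edges M E)
          {f \<in> fixed_points M V E. f v = 0} (set (legal_list V E es)))) \<and>
    (\<forall>inp vs. represents inp vs V E \<longrightarrow>
       (\<forall>s. \<exists>es t m s'. is_order es (E2 E) \<and>
          run inp (compute_E2;; enumerate_legal) s t m s' \<and>
          decoded_output vs s' = legal_list V E es \<and>
          within_bounds 300 M V E t m) \<and>
       (\<forall>es s. is_order es (E2 E) \<and> edge_table vs E es s \<longrightarrow>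
          (\<exists>t m s'. run inp enumerate_legal s t m s' \<and>
             decoded_output vs s' = legal_list V E es \<and>
             within_bounds 300 M V E t m)))"
  proof (intro conjI allI impI ballI)
    fix es assume order: "is_order es (E2 E)"
    show "distinct (legal_list V E es)" "set (legal_list V E es) = E_fix V E"
      using set_legal_list[OF tree order] by simp_all
    fix v assume "v \<in> V"
    then show "bij_betw (conflict_edges M E) {f \<in> fixed_points M V E. f v = 0} (set (legal_list V E es))"
      using bij_betw_conflict_edges[OF tree] set_legal_list(2)[OF tree order] by simp
  next
    fix inp vs s assume "represents inp vs V E"
    then interpret tree_input V E inp vs using tree by unfold_locales
    obtain t\<^sub>1 m\<^sub>1 s\<^sub>1 es where 1: "run inp compute_E2 s t\<^sub>1 m\<^sub>1 s\<^sub>1" "is_order es (E2 E)"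
      "edge_table vs E es s\<^sub>1" "t\<^sub>1 \<le> 20 + 80 * card V" "m\<^sub>1 \<le> 6 * e"
      using compute_E2_correct[of s] unfolding e_def by blast
    obtain t\<^sub>2 m\<^sub>2 s\<^sub>2 where 2: "run inp enumerate_legal s\<^sub>1 t\<^sub>2 m\<^sub>2 s\<^sub>2"
      "decoded_output vs s\<^sub>2 = legal_list V E es" "t\<^sub>2 \<le> 200 * (1 + F * e)" "m\<^sub>2 \<le> 200 * (e * F)"
      using enum[OF 1(2,3), of inp] by blast
    define P where "P = e * F"
    then have P: "e * F = P" "F * e = P" "e \<le> P" using F by simp_all
    then have "within_bounds 300 M V E (t\<^sub>1 + t\<^sub>2) (max m\<^sub>1 m\<^sub>2)"
      using 1(4,5) 2(3,4) V unfolding bounds P(1,2) by auto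
    then show "\<exists>es t m s'. is_order es (E2 E) \<and> run inp (compute_E2;; enumerate_legal) s t m s' \<and>
        decoded_output vs s' = legal_list V E es \<and> within_bounds 300 M V E t m"
      using 1(2) 2(2) run.Seq[OF 1(1) 2(1)] by blast
  next
    fix inp vs es s assume "is_order es (E2 E) \<and> edge_table vs E es s"
    then obtain t m s' where 2: "run inp enumerate_legal s t m s'"
      "decoded_output vs s' = legal_list V E es" "t \<le> 200 * (1 + F * e)" "m \<le> 200 * (e * F)"
      using enum[of es vs s inp] by blast
    then have "within_bounds 300 M V E t m" using V by (auto simp: bounds)
    with 2 show "\<exists>t m s'. run inp enumerate_legal s t m s' \<and>
        decoded_output vs s' = legal_list V E es \<and> within_bounds 300 M V E t m" by blast
  qed
qed

end
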